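(* Let $V$ be a $4$-dimensional real vector space with a positive definite inner product $(\cdot,\cdot)$, and fix an orientation of $V$. Let $R\in\otimes^4V^*$ be an algebraic curvature tensor on $V$, with associated Weyl operator $\mathcal{W}$. The following assertions are equivalent: (1) $R$ is conformally Osserman, i.e. the eigenvalues of $\mathcal{J}_W(x):y\mapsto\mathcal{W}(y,x)x$ are constant as $x$ ranges over the unit sphere of $V$. (2) $R$ is self-dual or anti-self-dual, i.e. its Weyl tensor $W$ is self-dual or anti-self-dual. (3) There exist a unitary quaternion structure $\{\Phi_1,\Phi_2,\Phi_3\}$ on $V$ and real numbers $\lambda_1,\lambda_2,\lambda_3$ with $\lambda_1+\lambda_2+\lambda_3=0$ such that $$\mathcal{W}(x,y)z=\lambda_1R_{\Phi_1}(x,y)z+\lambda_2R_{\Phi_2}(x,y)z+\lambda_3R_{\Phi_3}(x,y)z\quad\text{for all }x,y,z\in V.$$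
   Context: A tensor $R\in\otimes^4V^*$ is an algebraic curvature tensor if $$R(x,y,z,w)=-R(y,x,z,w)=R(z,w,x,y),$$ $$R(x,y,z,w)+R(y,z,x,w)+R(z,x,y,w)=0$$ for all $x,y,z,w\in V$. The associated curvature operator $\mathcal{R}(x,y)$ is characterized by $(\mathcal{R}(x,y)z,w)=R(x,y,z,w)$. The Ricci operator $\rho$ is defined by $(\rho x,y)=\operatorname{Tr}(z\mapsto\mathcal{R}(z,x)y)$, and $\tau=\operatorname{Tr}(\rho)$ is the scalar curvature. With $m=\dim V$ (here $m=4$), the Weyl operator is $$\mathcal{W}(x,y)z=\mathcal{R}(x,y)z+\frac{\tau}{(m-1)(m-2)}\mathcal{R}^0(x,y)z-\frac{1}{m-2}\mathcal{L}(x,y)z,$$ where $$\mathcal{R}^0(x,y)z=(y,z)x-(x,z)y,$$ $$\mathcal{L}(x,y)z=(\rho y,z)x-(\rho x,z)y+(y,z)\rho x-(x,z)\rho y.$$ The Weyl tensor is $W(x,y,z,w)=(\mathcal{W}(x,y)z,w)$. With respect to an orthonormal basis $\{e_i\}$ of $V$ with dual basis $\{e^i\}$, write $W_{ijkl}=W(e_i,e_j,e_k,e_l)$. Then $W$ acts linearly on $\Lambda^2(V^* )$ by $\mathcal{W}(e^p\wedge e^q)=\frac12\sum_{i,j}W_{pqij}\,e^i\wedge e^j$. Let $\Lambda^{\pm}$ be the $\pm1$ eigenspaces of the Hodge star operator on $\Lambda^2(V^* )$. $W$ is self-dual if this action vanishes identically on $\Lambda^-$, and anti-self-dual if it vanishes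 identically on $\Lambda^+$. A unitary quaternion structure on $V$ is a triple $\{\Phi_1,\Phi_2,\Phi_3\}$ of skew-adjoint endomorphisms of $V$ satisfying $\Phi_i\Phi_j+\Phi_j\Phi_i=-2\delta_{ij}\operatorname{id}$ for all $i,j\in\{1,2,3\}$. For a skew-adjoint endomorphism $\Phi$ of $V$ with $\Phi^2=-\operatorname{id}$, define $$R_\Phi(x,y)z=(\Phi y,z)\Phi x-(\Phi x,z)\Phi y-2(\Phi x,y)\Phi z.$$ *)

theory Defs
  imports "HOL-Analysis.Analysis"
begin

section \<open>Algebraic curvature tensors and the Weyl operator\<close>

definition algebraic_curvature_tensor ::
    "('a::euclidean_space \<Rightarrow> 'a \<Rightarrow> 'a \<Rightarrow> 'a \<Rightarrow> real) \<Rightarrow> bool" where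
  "algebraic_curvature_tensor R \<longleftrightarrow>
     (\<forall>y z w. linear (\<lambda>x. R x y z w)) \<and> (\<forall>x z w. linear (\<lambda>y. R x y z w)) \<and>
     (\<forall>x y w. linear (\<lambda>z. R x y z w)) \<and> (\<forall>x y z. linear (\<lambda>w. R x y z w)) \<and>
     (\<forall>x y z w. R x y z w = - R y x z w \<and> R x y z w = R z w x y) \<and>
     (\<forall>x y z w. R x y z w + R y z x w + R z x y w = 0)"

definition Tr :: "('a::euclidean_space \<Rightarrow> 'a) \<Rightarrow> real" where
  "Tr T = (\<Sum>b\<in>Basis. T b \<bullet> b)"

definition curvature_op ::
    "('a::euclidean_space \<Rightarrow> 'a \<Rightarrow> 'a \<Rightarrow> 'a \<Rightarrow> real) \<Rightarrow> 'a \<Rightarrow> 'a \<Rightarrow> 'a \<Rightarrow> 'a" where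
  "curvature_op R x y z = (THE v. \<forall>w. v \<bullet> w = R x y z w)"

definition ricci_op ::
    "('a::euclidean_space \<Rightarrow> 'a \<Rightarrow> 'a \<Rightarrow> 'a \<Rightarrow> real) \<Rightarrow> 'a \<Rightarrow> 'a" where
  "ricci_op R x = (THE v. \<forall>y. v \<bullet> y = Tr (\<lambda>z. curvature_op R z x y))"

definition scalar_curvature ::
    "('a::euclidean_space \<Rightarrow> 'a \<Rightarrow> 'a \<Rightarrow> 'a \<Rightarrow> real) \<Rightarrow> real" where
  "scalar_curvature R = Tr (ricci_op R)"

definition R0_op :: "'a::euclidean_space \<Rightarrow> 'a \<Rightarrow> 'a \<Rightarrow> 'a" where
  "R0_op x y z = (y \<bullet> z) *\<^sub>R x - (x \<bullet> z) *\<^sub>R y"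

definition L_op ::
    "('a::euclidean_space \<Rightarrow> 'a \<Rightarrow> 'a \<Rightarrow> 'a \<Rightarrow> real) \<Rightarrow> 'a \<Rightarrow> 'a \<Rightarrow> 'a \<Rightarrow> 'a" where
  "L_op R x y z =
     (ricci_op R y \<bullet> z) *\<^sub>R x - (ricci_op R x \<bullet> z) *\<^sub>R y
     + (y \<bullet> z) *\<^sub>R ricci_op R x - (x \<bullet> z) *\<^sub>R ricci_op R y"

definition weyl_op ::
    "('a::euclidean_space \<Rightarrow> 'a \<Rightarrow> 'a \<Rightarrow> 'a \<Rightarrow> real) \<Rightarrow> 'a \<Rightarrow> 'a \<Rightarrow> 'a \<Rightarrow> 'a" where
  "weyl_op R x y z =
     curvature_op R x y z
     + (scalar_curvature R / ((real DIM('a) - 1) * (real DIM('a) - 2))) *\<^sub>R R0_op x y z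
     - (1 / (real DIM('a) - 2)) *\<^sub>R L_op R x y z"

definition weyl_tensor ::
    "('a::euclidean_space \<Rightarrow> 'a \<Rightarrow> 'a \<Rightarrow> 'a \<Rightarrow> real) \<Rightarrow> 'a \<Rightarrow> 'a \<Rightarrow> 'a \<Rightarrow> 'a \<Rightarrow> real" where
  "weyl_tensor R x y z w = weyl_op R x y z \<bullet> w"


section \<open>The conformal Osserman condition\<close>

definition eigenvalues :: "('a::real_vector \<Rightarrow> 'a) \<Rightarrow> real set" where
  "eigenvalues T = {\<mu>. \<exists>v. v \<noteq> 0 \<and> T v = \<mu> *\<^sub>R v}"

definition weyl_jacobi_op ::
    "('a::euclidean_space \<Rightarrow> 'a \<Rightarrow> 'a \<Rightarrow> 'a \<Rightarrow> real) \<Rightarrow> 'a \<Rightarrow> 'a \<Rightarrow> 'a" where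
  "weyl_jacobi_op R x y = weyl_op R y x x"

text \<open>Each operator \<open>weyl_jacobi_op R x\<close> is self-adjoint, so its real eigenvalues are all of
  its eigenvalues.  Constancy refers to the set of eigenvalues; since the unit sphere is
  connected, this forces the multiplicities to be constant as well.\<close>

definition conformally_osserman ::
    "('a::euclidean_space \<Rightarrow> 'a \<Rightarrow> 'a \<Rightarrow> 'a \<Rightarrow> real) \<Rightarrow> bool" where
  "conformally_osserman R \<longleftrightarrow>
     (\<forall>x\<in>sphere 0 1. \<forall>x'\<in>sphere 0 1.
        eigenvalues (weyl_jacobi_op R x) = eigenvalues (weyl_jacobi_op R x'))"


section \<open>Orientations, two-forms and the Hodge star in dimension four\<close>

text \<open>Ordered bases and frames are indexed by the four-element type \<open>4\<close>, whose elements are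
  \<open>1, 2, 3, 4\<close> (with \<open>4 = 0\<close>).  An orientation is an equivalence class of ordered bases
  under having a change-of-basis matrix of positive determinant.\<close>

definition ordered_basis :: "(4 \<Rightarrow> 'a::euclidean_space) \<Rightarrow> bool" where
  "ordered_basis b \<longleftrightarrow> inj b \<and> independent (range b) \<and> span (range b) = UNIV"

definition same_orientation :: "(4 \<Rightarrow> 'a::euclidean_space) \<Rightarrow> (4 \<Rightarrow> 'a) \<Rightarrow> bool" where
  "same_orientation b c \<longleftrightarrow>
     (\<exists>A :: real^4^4. det A > 0 \<and> (\<forall>j. c j = (\<Sum>i\<in>UNIV. A $ i $ j *\<^sub>R b i)))"

definition orientations :: "(4 \<Rightarrow> 'a::euclidean_space) set set" where
  "orientations =
     Collect ordered_basis //
       {(b, c). ordered_basis b \<and> ordered_basis c \<and> same_orientation b c}"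

definition orthonormal_frame :: "(4 \<Rightarrow> 'a::euclidean_space) \<Rightarrow> bool" where
  "orthonormal_frame e \<longleftrightarrow> (\<forall>i j. e i \<bullet> e j = (if i = j then 1 else 0))"

definition oriented_frame :: "(4 \<Rightarrow> 'a::euclidean_space) set \<Rightarrow> 4 \<Rightarrow> 'a" where
  "oriented_frame \<O> = (SOME e. e \<in> \<O> \<and> orthonormal_frame e)"

definition two_forms :: "('a::euclidean_space \<Rightarrow> 'a \<Rightarrow> real) set" where
  "two_forms = {\<omega>. bilinear \<omega> \<and> (\<forall>x y. \<omega> x y = - \<omega> y x)}"

text \<open>The wedge of two covectors.  The covector dual to a member \<open>e\<close> of an orthonormal basis
  is \<open>inner e\<close>.\<close>

definition wedge :: "('a \<Rightarrow> real) \<Rightarrow> ('a \<Rightarrow> real) \<Rightarrow> 'a \<Rightarrow> 'a \<Rightarrow> real" where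
  "wedge \<alpha> \<beta> x y = \<alpha> x * \<beta> y - \<alpha> y * \<beta> x"

text \<open>On a positively oriented orthonormal frame the Hodge star sends
  \<open>e\<^sup>p\<^sup>1 \<and> e\<^sup>p\<^sup>2\<close> to \<open>sign p \<cdot> e\<^sup>p\<^sup>3 \<and> e\<^sup>p\<^sup>4\<close> for every permutation \<open>p\<close> of the indices.
  Each \<open>e\<^sup>i \<and> e\<^sup>j\<close> with \<open>i < j\<close> arises from four permutations, which accounts for the
  factor \<open>1/4\<close>.  The result does not depend on the positively oriented orthonormal frame.\<close>

definition hodge_star ::
    "(4 \<Rightarrow> 'a::euclidean_space) set \<Rightarrow> ('a \<Rightarrow> 'a \<Rightarrow> real) \<Rightarrow> 'a \<Rightarrow> 'a \<Rightarrow> real" where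
  "hodge_star \<O> \<omega> x y =
     (let e = oriented_frame \<O> in
      (1/4) * (\<Sum>p | p permutes (UNIV :: 4 set).
         of_int (sign p) * \<omega> (e (p 1)) (e (p 2))
           * wedge (inner (e (p 3))) (inner (e (p 4))) x y))"

definition Lambda_plus ::
    "(4 \<Rightarrow> 'a::euclidean_space) set \<Rightarrow> ('a \<Rightarrow> 'a \<Rightarrow> real) set" where
  "Lambda_plus \<O> = {\<omega> \<in> two_forms. hodge_star \<O> \<omega> = \<omega>}"

definition Lambda_minus ::
    "(4 \<Rightarrow> 'a::euclidean_space) set \<Rightarrow> ('a \<Rightarrow> 'a \<Rightarrow> real) set" where
  "Lambda_minus \<O> = {\<omega> \<in> two_forms. \<forall>x y. hodge_star \<O> \<omega> x y = - \<omega> x y}"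


section \<open>Self-duality\<close>

text \<open>The linear extension of \<open>e\<^sup>p \<and> e\<^sup>q \<mapsto> 1/2 \<Sum>\<^sub>i\<^sub>j W\<^sub>p\<^sub>q\<^sub>i\<^sub>j e\<^sup>i \<and> e\<^sup>j\<close>, using
  \<open>\<omega> = 1/2 \<Sum>\<^sub>p\<^sub>q \<omega>(e\<^sub>p, e\<^sub>q) e\<^sup>p \<and> e\<^sup>q\<close>, where \<open>Basis\<close> serves as the orthonormal basis.\<close>

definition two_form_action ::
    "('a::euclidean_space \<Rightarrow> 'a \<Rightarrow> 'a \<Rightarrow> 'a \<Rightarrow> real) \<Rightarrow>
     ('a \<Rightarrow> 'a \<Rightarrow> real) \<Rightarrow> 'a \<Rightarrow> 'a \<Rightarrow> real" where
  "two_form_action W \<omega> x y =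
     (1/2) * (\<Sum>p\<in>Basis. \<Sum>q\<in>Basis. \<omega> p q *
       ((1/2) * (\<Sum>i\<in>Basis. \<Sum>j\<in>Basis. W p q i j * wedge (inner i) (inner j) x y)))"

lemma two_form_action_wedge:
  assumes "\<And>x y z w. W x y z w = - W y x z w" and "p \<in> Basis" and "q \<in> Basis"
  shows "two_form_action W (wedge (inner p) (inner q)) x y =
    (1/2) * (\<Sum>i\<in>Basis. \<Sum>j\<in>Basis. W p q i j * wedge (inner i) (inner j) x y)"
proof -
  define g where
    "g r s = (1/2) * (\<Sum>i\<in>Basis. \<Sum>j\<in>Basis. W r s i j * wedge (inner i) (inner j) x y)" for r s
  have g: "g s r = - g r s" for r s
    using assms(1)[of s r] by (simp add: g_def sum_negf)
  have w: "wedge (inner p) (inner q) r s * g r s =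
      (if r = p then if s = q then g r s else 0 else 0)
      - (if r = q then if s = p then g r s else 0 else 0)"
    if "r \<in> Basis" "s \<in> Basis" for r s
    using that assms(2,3) by (auto simp: wedge_def inner_Basis)
  have "two_form_action W (wedge (inner p) (inner q)) x y =
      (1/2) * (\<Sum>r\<in>Basis. \<Sum>s\<in>Basis. wedge (inner p) (inner q) r s * g r s)"
    by (simp add: two_form_action_def g_def)
  also have "(\<Sum>r\<in>Basis. \<Sum>s\<in>Basis. wedge (inner p) (inner q) r s * g r s) =
      (\<Sum>r\<in>Basis. \<Sum>s\<in>Basis. (if r = p then if s = q then g r s else 0 else 0)
        - (if r = q then if s = p then g r s else 0 else 0))"
    by (intro sum.cong refl w)
  also have "\<dots> = (\<Sum>r\<in>Basis. if r = p then g r q else 0)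
        - (\<Sum>r\<in>Basis. if r = q then g r p else 0)"
    using assms(2,3)
    by (subst sum_subtractf[symmetric], intro sum.cong refl) (auto simp: sum_subtractf)
  also have "\<dots> = g p q - g q p"
    using assms(2,3) by simp
  finally show ?thesis
    using g[of p q] by (simp add: g_def)
qed

definition self_dual ::
    "(4 \<Rightarrow> 'a::euclidean_space) set \<Rightarrow> ('a \<Rightarrow> 'a \<Rightarrow> 'a \<Rightarrow> 'a \<Rightarrow> real) \<Rightarrow> bool" where
  "self_dual \<O> W \<longleftrightarrow> (\<forall>\<omega>\<in>Lambda_minus \<O>. \<forall>x y. two_form_action W \<omega> x y = 0)"

definition anti_self_dual ::
    "(4 \<Rightarrow> 'a::euclidean_space) set \<Rightarrow> ('a \<Rightarrow> 'a \<Rightarrow> 'a \<Rightarrow> 'a \<Rightarrow> real) \<Rightarrow> bool" where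
  "anti_self_dual \<O> W \<longleftrightarrow> (\<forall>\<omega>\<in>Lambda_plus \<O>. \<forall>x y. two_form_action W \<omega> x y = 0)"


section \<open>Unitary quaternion structures\<close>

definition skew_adjoint :: "('a::real_inner \<Rightarrow> 'a) \<Rightarrow> bool" where
  "skew_adjoint \<Phi> \<longleftrightarrow> linear \<Phi> \<and> (\<forall>x y. \<Phi> x \<bullet> y = - (x \<bullet> \<Phi> y))"

definition unitary_quaternion_structure :: "(nat \<Rightarrow> 'a::real_inner \<Rightarrow> 'a) \<Rightarrow> bool" where
  "unitary_quaternion_structure \<Phi> \<longleftrightarrow>
     (\<forall>i\<in>{1,2,3}. skew_adjoint (\<Phi> i)) \<and>
     (\<forall>i\<in>{1,2,3}. \<forall>j\<in>{1,2,3}. \<forall>x.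
        \<Phi> i (\<Phi> j x) + \<Phi> j (\<Phi> i x) = (- 2 * (if i = j then 1 else 0)) *\<^sub>R x)"

definition R_Phi :: "('a::real_inner \<Rightarrow> 'a) \<Rightarrow> 'a \<Rightarrow> 'a \<Rightarrow> 'a \<Rightarrow> 'a" where
  "R_Phi \<Phi> x y z =
     (\<Phi> y \<bullet> z) *\<^sub>R \<Phi> x - (\<Phi> x \<bullet> z) *\<^sub>R \<Phi> y - (2 * (\<Phi> x \<bullet> y)) *\<^sub>R \<Phi> z"

end

theory Submission
  imports Defs
begin

text \<open>
  In an orthonormal frame, the forms \<open>e\<^sup>1 \<and> e\<^sup>2 \<plusminus> e\<^sup>3 \<and> e\<^sup>4\<close> and their two companions are the
  fundamental forms of two commuting quaternion structures, one for each eigenspace of the Hodge star.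
  Ricci-flatness of the Weyl tensor makes its action on two-forms block diagonal for
  \<open>\<Lambda>\<^sup>+ \<oplus> \<Lambda>\<^sup>-\<close>, and diagonalizing the two symmetric trace-free blocks gives
  \<open>W = \<Sum> \<alpha>\<^sub>k \<phi>\<^sub>k \<otimes> \<phi>\<^sub>k + \<Sum> \<beta>\<^sub>k \<psi>\<^sub>k \<otimes> \<psi>\<^sub>k\<close> with commuting quaternion structures \<open>\<Phi>\<close>, \<open>\<Psi>\<close>;
  self-duality means \<open>\<beta> = 0\<close> and anti-self-duality \<open>\<alpha> = 0\<close>.

  For every permutation \<open>\<sigma>\<close> some unit vector \<open>x\<close> has \<open>\<Psi>\<^sub>\<sigma>\<^sub>k x = \<plusminus>\<Phi>\<^sub>k x\<close> for all \<open>k\<close>, so the Jacobi operator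
  at \<open>x\<close> has the eigenvalues \<open>0\<close> and \<open>-(\<alpha>\<^sub>k + \<beta>\<^sub>\<sigma>\<^sub>k)\<close>.  If the eigenvalues do not depend on \<open>x\<close>, then,
  since they sum to zero, the sum of their squares is determined by their maximum and minimum, so
  \<open>\<Sum> \<alpha>\<^sub>k \<beta>\<^sub>\<sigma>\<^sub>k\<close> does not depend on \<open>\<sigma>\<close>; transpositions give
  \<open>(\<alpha>\<^sub>i - \<alpha>\<^sub>j)(\<beta>\<^sub>k - \<beta>\<^sub>l) = 0\<close>, hence \<open>\<alpha> = 0\<close> or \<open>\<beta> = 0\<close>.
\<close>

section \<open>Orthonormal frames\<close>

lemma orthonormal_frame_independent:
  fixes e :: "4 \<Rightarrow> 'a::euclidean_space"
  assumes "orthonormal_frame e"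
  shows "inj e" "independent (range e)"
proof -
  have inn: "e i \<bullet> e j = (if i = j then 1 else 0)" for i j
    using assms by (simp add: orthonormal_frame_def)
  show "inj e"
    by (rule injI) (metis inn zero_neq_one)
  show "independent (range e)"
    by (rule pairwise_orthogonal_independent)
      (auto simp: pairwise_def orthogonal_def inn, metis inn inner_zero_left zero_neq_one)
qed

lemma orthonormal_frame_expand:
  fixes e :: "4 \<Rightarrow> 'a::euclidean_space"
  assumes dim: "DIM('a) = 4" and e: "orthonormal_frame e"
  shows "(\<Sum>i\<in>UNIV. (x \<bullet> e i) *\<^sub>R e i) = x"
proof -
  have inn: "e i \<bullet> e j = (if i = j then 1 else 0)" for i j
    using e by (simp add: orthonormal_frame_def)
  have "card (range e) = DIM('a)"
    using orthonormal_frame_independent(1)[OF e] dim by (simp add: card_image)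
  with orthonormal_frame_independent(2)[OF e] have span: "span (range e) = UNIV"
    by (metis card_eq_dim dim_UNIV finite_imageI finite_class.finite_UNIV subset_UNIV top.extremum_uniqueI)
  define y where "y = x - (\<Sum>i\<in>UNIV. (x \<bullet> e i) *\<^sub>R e i)"
  have "y \<bullet> e j = 0" for j
    by (simp add: y_def inner_diff_left inner_sum_left inn if_distrib sum.delta cong: if_cong)
  then have "orthogonal y z" if "z \<in> span (range e)" for z
    using that by (intro orthogonal_to_span[of z "range e"]) (auto simp: orthogonal_def)
  then have "y \<bullet> y = 0"
    using span by (auto simp: orthogonal_def)
  then show ?thesis by (simp add: y_def)
qed

locale frame4 =
  fixes e :: "4 \<Rightarrow> 'a::euclidean_space"
  assumes dim4: "DIM('a) = 4" and frame: "orthonormal_frame e"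
begin

lemma inner_e: "e i \<bullet> e j = (if i = j then 1 else 0)"
  using frame by (simp add: orthonormal_frame_def)

lemma expand: "(\<Sum>i\<in>UNIV. (x \<bullet> e i) *\<^sub>R e i) = x"
  using orthonormal_frame_expand[OF dim4 frame] .

lemma eqI:
  assumes "\<And>i. x \<bullet> e i = y \<bullet> e i" shows "x = y"
proof -
  have "x = (\<Sum>i\<in>UNIV. (x \<bullet> e i) *\<^sub>R e i)" by (rule expand[symmetric])
  also have "\<dots> = y" unfolding assms by (rule expand)
  finally show ?thesis .
qed

lemma linear_expand:
  assumes "linear f" shows "f x = (\<Sum>i\<in>UNIV. (x \<bullet> e i) *\<^sub>R f (e i))"
proof -
  have "f x = f (\<Sum>i\<in>UNIV. (x \<bullet> e i) *\<^sub>R e i)" by (simp only: expand)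
  also have "\<dots> = (\<Sum>i\<in>UNIV. f ((x \<bullet> e i) *\<^sub>R e i))" by (rule linear_sum[OF assms])
  finally show ?thesis by (simp only: linear_scale[OF assms])
qed

text \<open>The definitions contract over \<open>Basis\<close>, while the Hodge star uses an
  oriented frame; basis independence of traces carries contractions from one to the other.\<close>

lemma trace_frame:
  fixes g :: "'a \<Rightarrow> 'a \<Rightarrow> real"
  assumes g: "bilinear g"
  shows "(\<Sum>b\<in>Basis. g b b) = (\<Sum>i\<in>UNIV. g (e i) (e i))"
proof -
  have 1: "linear (\<lambda>x. g x y)" and 2: "linear (g x)" for x y
    using g by (auto simp: bilinear_def)
  have "g b b = (\<Sum>i\<in>UNIV. \<Sum>j\<in>UNIV. (e i \<bullet> b) * (e j \<bullet> b) * g (e i) (e j))" for b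
  proof -
    have "g b b = (\<Sum>i\<in>UNIV. (b \<bullet> e i) *\<^sub>R g (e i) b)" by (rule linear_expand[OF 1])
    also have "\<dots> = (\<Sum>i\<in>UNIV. (b \<bullet> e i) *\<^sub>R (\<Sum>j\<in>UNIV. (b \<bullet> e j) *\<^sub>R g (e i) (e j)))"
      by (intro sum.cong refl arg_cong[of _ _ "scaleR _"] linear_expand[OF 2])
    finally show ?thesis by (simp add: sum_distrib_left mult.assoc inner_commute[of b])
  qed
  then have "(\<Sum>b\<in>Basis. g b b)
      = (\<Sum>b\<in>Basis. \<Sum>i\<in>UNIV. \<Sum>j\<in>UNIV. (e i \<bullet> b) * (e j \<bullet> b) * g (e i) (e j))" by simp
  also have "\<dots> = (\<Sum>i\<in>UNIV. \<Sum>j\<in>UNIV. \<Sum>b\<in>Basis. (e i \<bullet> b) * (e j \<bullet> b) * g (e i) (e j))"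
    by (subst sum.swap, intro sum.cong refl, subst sum.swap, rule refl)
  also have "\<dots> = (\<Sum>i\<in>UNIV. \<Sum>j\<in>UNIV. (e i \<bullet> e j) * g (e i) (e j))"
    by (simp add: euclidean_inner[of "e _" "e _"] sum_distrib_right)
  also have "\<dots> = (\<Sum>i\<in>UNIV. \<Sum>j\<in>UNIV. if j = i then g (e i) (e i) else 0)"
    by (intro sum.cong refl) (auto simp: inner_e)
  finally show ?thesis by simp
qed

end

section \<open>Orthonormal frames inside a given orientation\<close>

lemma ex_orthonormal_frame:
  assumes "DIM('a::euclidean_space) = 4"
  shows "\<exists>f :: 4 \<Rightarrow> 'a. orthonormal_frame f"
proof -
  obtain f :: "4 \<Rightarrow> 'a" where f: "bij_betw f UNIV Basis"
    using finite_same_card_bij[of "UNIV :: 4 set" "Basis :: 'a set"] assms by auto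
  have "f i \<in> Basis" and "f i = f j \<longleftrightarrow> i = j" for i j
    using f by (auto simp: bij_betw_def inj_on_def)
  then have "orthonormal_frame f" by (simp add: orthonormal_frame_def inner_Basis)
  then show ?thesis by blast
qed

lemma orthonormal_frame_ordered_basis:
  fixes e :: "4 \<Rightarrow> 'a::euclidean_space"
  assumes dim: "DIM('a) = 4" and e: "orthonormal_frame e"
  shows "ordered_basis e"
proof -
  have "x \<in> span (range e)" for x
    by (subst orthonormal_frame_expand[OF assms, of x, symmetric])
      (intro span_sum span_scale span_base, auto)
  then show ?thesis
    using orthonormal_frame_independent[OF e] by (auto simp: ordered_basis_def)
qed

text \<open>\<open>oriented_frame\<close> is chosen by \<open>SOME\<close>, so an orthonormal member
  of the orientation class must be exhibited. Any orthonormal frame serves once its first vector is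
  reversed where the orientation is wrong.\<close>

lemma oriented_frame_orthonormal:
  fixes \<O> :: "(4 \<Rightarrow> 'a::euclidean_space) set"
  assumes dim: "DIM('a) = 4" and or: "\<O> \<in> orientations"
  shows "orthonormal_frame (oriented_frame \<O>)"
proof -
  obtain b where b: "ordered_basis b"
    and \<O>: "\<O> = {c. ordered_basis c \<and> same_orientation b c}"
    using or by (auto simp: orientations_def quotient_def Image_def)
  obtain f :: "4 \<Rightarrow> 'a" where f: "orthonormal_frame f"
    using ex_orthonormal_frame[OF dim] by blast
  interpret frame4 f by standard (fact dim f)+
  have inj: "inj b" and sp: "span (range b) = UNIV"
    using b by (auto simp: ordered_basis_def)
  have "\<exists>u. (\<Sum>i\<in>UNIV. u i *\<^sub>R b i) = f j" for j
  proof -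
    have "f j \<in> span (range b)" using sp by simp
    then obtain u where "(\<Sum>v\<in>range b. u v *\<^sub>R v) = f j"
      by (subst (asm) span_finite) auto
    then show ?thesis by (intro exI[of _ "u \<circ> b"]) (simp add: sum.reindex[OF inj])
  qed
  then obtain u where u: "(\<Sum>i\<in>UNIV. u j i *\<^sub>R b i) = f j" for j by metis
  \<comment> \<open>\<open>B\<close> is the change of basis from \<open>b\<close> to
    \<open>f\<close>, and \<open>C\<close> holds the coordinates of \<open>b\<close> in
    \<open>f\<close>. Orthonormality of \<open>f\<close> makes their product the identity, so
    \<open>B\<close> is invertible.\<close>
  define B :: "real^4^4" where "B = (\<chi> i j. u j i)"
  define C :: "real^4^4" where "C = (\<chi> k i. b i \<bullet> f k)"
  have "C ** B = mat 1"
  proof (simp add: vec_eq_iff matrix_matrix_mult_def mat_def B_def C_def, intro allI)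
    fix k j
    have "(\<Sum>i\<in>UNIV. (b i \<bullet> f k) * u j i) = f j \<bullet> f k"
      by (simp add: u[symmetric] inner_sum_left mult.commute)
    then show "(k = j \<longrightarrow> (\<Sum>i\<in>UNIV. (b i \<bullet> f j) * u j i) = 1) \<and>
        (k \<noteq> j \<longrightarrow> (\<Sum>i\<in>UNIV. (b i \<bullet> f k) * u j i) = 0)"
      by (auto simp: inner_e)
  qed
  then have "det C * det B = 1" by (metis det_I det_mul)
  then have B0: "det B \<noteq> 0" by auto
  \<comment> \<open>Multiplying the first column by the sign of \<open>det B\<close> makes the
    determinant positive and keeps the frame orthonormal.\<close>
  define d where "d i = (if i = 1 then sgn (det B) else 1)" for i :: 4
  define D :: "real^4^4" where "D = (\<chi> i j. if i = j then d i else 0)"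
  have dd: "d i * d i = 1" for i using B0 by (auto simp: d_def sgn_if)
  have "det D = sgn (det B)"
    by (subst det_diagonal) (simp_all add: D_def d_def)
  then have pos: "det (B ** D) > 0"
    using B0 by (simp add: det_mul sgn_if)
  define c where "c j = d j *\<^sub>R f j" for j
  have c: "orthonormal_frame c"
    using f dd by (auto simp: orthonormal_frame_def c_def)
  have "(B ** D) $ i $ j = d j * u j i" for i j
  proof -
    have "(B ** D) $ i $ j = (\<Sum>k\<in>UNIV. u k i * (if k = j then d k else 0))"
      by (simp add: matrix_matrix_mult_def D_def B_def)
    also have "\<dots> = (\<Sum>k\<in>UNIV. if k = j then d j * u j i else 0)"
      by (intro sum.cong) auto
    finally show ?thesis by simp
  qed
  then have "c j = (\<Sum>i\<in>UNIV. (B ** D) $ i $ j *\<^sub>R b i)" for j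
    unfolding c_def u[of j, symmetric] by (simp add: scaleR_sum_right)
  with pos have "same_orientation b c" by (auto simp: same_orientation_def)
  then have "c \<in> \<O> \<and> orthonormal_frame c"
    using c orthonormal_frame_ordered_basis[OF dim c] by (simp add: \<O>)
  then show ?thesis
    unfolding oriented_frame_def using someI[of "\<lambda>e. e \<in> \<O> \<and> orthonormal_frame e" c] by simp
qed

section \<open>The Weyl tensor\<close>

lemma bilinearI:
  assumes "\<And>y. linear (\<lambda>x. g x y)" "\<And>x. linear (\<lambda>y. g x y)"
  shows "bilinear g"
  using assms by (simp add: bilinear_def)

text \<open>\<open>curvature_op\<close> and \<open>ricci_op\<close> are definite descriptions of
  representing vectors; linearity gives existence and nondegeneracy uniqueness, so both unfold under
  an inner product.\<close>

lemma riesz_representation_the: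
  fixes g :: "'a::euclidean_space \<Rightarrow> real"
  assumes "linear g"
  shows "(THE v. \<forall>w. v \<bullet> w = g w) \<bullet> w = g w"
proof -
  define v where "v = (\<Sum>b\<in>Basis. g b *\<^sub>R b)"
  have "g w = g (\<Sum>b\<in>Basis. (w \<bullet> b) *\<^sub>R b)" for w by (simp add: euclidean_representation)
  also have "\<dots> w = v \<bullet> w" for w
    by (simp add: v_def linear_sum[OF assms] linear_scale[OF assms] inner_sum_left
        inner_commute[of w] mult.commute)
  finally have v: "\<forall>w. v \<bullet> w = g w" by simp
  then have "(THE v. \<forall>w. v \<bullet> w = g w) = v"
    by (intro the_equality) (simp, metis vector_eq_ldot vector_eq_rdot)
  with v show ?thesis by simp
qed

lemma curvature_tensorD:
  assumes "algebraic_curvature_tensor R"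
  shows "linear (\<lambda>x. R x y z w)" "linear (\<lambda>y. R x y z w)" "linear (\<lambda>z. R x y z w)"
    "linear (\<lambda>w. R x y z w)" "R x y z w = - R y x z w" "R x y z w = R z w x y"
    "R x y z w + R y z x w + R z x y w = 0"
  using assms unfolding algebraic_curvature_tensor_def by blast+

lemma curvature_op_inner:
  assumes "algebraic_curvature_tensor R"
  shows "curvature_op R x y z \<bullet> w = R x y z w"
  unfolding curvature_op_def by (rule riesz_representation_the) (rule curvature_tensorD[OF assms])

lemma ricci_op_inner:
  assumes R: "algebraic_curvature_tensor R"
  shows "ricci_op R x \<bullet> y = (\<Sum>b\<in>Basis. R b x y b)"
proof -
  have "linear (\<lambda>y. \<Sum>b\<in>Basis. R b x y b)"
    by (intro linear_compose_sum ballI curvature_tensorD[OF R])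
  then show ?thesis
    unfolding ricci_op_def Tr_def by (simp only: curvature_op_inner[OF R] riesz_representation_the)
qed

lemma ricci_op_sym:
  assumes R: "algebraic_curvature_tensor R"
  shows "ricci_op R x \<bullet> y = ricci_op R y \<bullet> x"
proof -
  have "R b x y b = R b y x b" for b
    using curvature_tensorD(5)[OF R, of b x y b] curvature_tensorD(6)[OF R, of b y x b]
      curvature_tensorD(6)[OF R, of b x y b] curvature_tensorD(5)[OF R, of x b b y]
      curvature_tensorD(5)[OF R, of y b b x]
      curvature_tensorD(6)[OF R, of x b y b] curvature_tensorD(5)[OF R, of y b x b] 
    by simp
  then show ?thesis by (simp add: ricci_op_inner[OF R])
qed

lemma linear_ricci_op:
  assumes R: "algebraic_curvature_tensor R"
  shows "linear (\<lambda>x. ricci_op R x \<bullet> y)"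
  unfolding ricci_op_inner[OF R]
  by (intro linear_compose_sum ballI curvature_tensorD[OF R])

lemma weyl_tensor_eq:
  assumes R: "algebraic_curvature_tensor (R :: 'a::euclidean_space \<Rightarrow> _)" and dim: "DIM('a) = 4"
  shows "weyl_tensor R x y z w = R x y z w
    + (scalar_curvature R / 6) * ((y \<bullet> z) * (x \<bullet> w) - (x \<bullet> z) * (y \<bullet> w))
    - ((ricci_op R y \<bullet> z) * (x \<bullet> w) - (ricci_op R x \<bullet> z) * (y \<bullet> w)
       + (y \<bullet> z) * (ricci_op R x \<bullet> w) - (x \<bullet> z) * (ricci_op R y \<bullet> w)) / 2"
  by (simp add: weyl_tensor_def weyl_op_def R0_op_def L_op_def dim curvature_op_inner[OF R]
      inner_add_left inner_diff_left)

text \<open>The correction terms are Kulkarni-Nomizu products of the symmetric forms given by the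
  metric and the Ricci operator, and such products have all the curvature symmetries.\<close>

lemma weyl_curvature_tensor:
  assumes R: "algebraic_curvature_tensor (R :: 'a::euclidean_space \<Rightarrow> _)" and dim: "DIM('a) = 4"
  shows "algebraic_curvature_tensor (weyl_tensor R)"
proof -
  let ?W = "weyl_tensor R"
  define r where "r x y = ricci_op R x \<bullet> y" for x y
  note W = weyl_tensor_eq[OF R dim, folded r_def]
  note dist = algebra_simps add_divide_distrib diff_divide_distrib
  have sym: "r x y = r y x" for x y
    unfolding r_def by (rule ricci_op_sym[OF R])
  have anti: "?W x y z w = - ?W y x z w" for x y z w
    using curvature_tensorD(5)[OF R, of x y z w] by (simp add: W dist)
  have pair: "?W x y z w = ?W z w x y" for x y z w
    using curvature_tensorD(6)[OF R, of x y z w] by (simp add: W dist inner_commute sym)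
  have bianchi: "?W x y z w + ?W y z x w + ?W z x y w = 0" for x y z w
    using curvature_tensorD(7)[OF R, of x y z w] by (simp add: W dist inner_commute sym)
  have lin1: "linear (\<lambda>x. ?W x y z w)" for y z w
  proof (rule linearI)
    note l = linear_add[OF curvature_tensorD(1)[OF R]] linear_scale[OF curvature_tensorD(1)[OF R]]
      linear_add[OF linear_ricci_op[OF R], folded r_def]
      linear_scale[OF linear_ricci_op[OF R], folded r_def]
    show "?W (a + b) y z w = ?W a y z w + ?W b y z w" for a b
      by (simp add: W l inner_add_left dist)
    show "?W (c *\<^sub>R a) y z w = c *\<^sub>R ?W a y z w" for c a
      by (simp add: W l dist)
  qed
  \<comment> \<open>The symmetries carry linearity from the first slot to the other three.\<close>
  have lin2: "linear (\<lambda>x. ?W y x z w)" for y z w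
    unfolding anti[of y _ z w] by (intro linear_compose_neg lin1)
  have lin3: "linear (\<lambda>x. ?W y z x w)" for y z w
    unfolding pair[of y z _ w] by (rule lin1)
  have lin4: "linear (\<lambda>x. ?W y z w x)" for y z w
    unfolding pair[of y z w _] by (rule lin2)
  show ?thesis
    unfolding algebraic_curvature_tensor_def
    by (intro conjI allI lin1 lin2 lin3 lin4 anti pair bianchi)
qed

text \<open>In dimension four \<open>R0_op\<close> traces to 3 times the metric and
  \<open>L_op\<close> to twice the Ricci form plus the scalar curvature times the metric, so the
  weights 1/6 and 1/2 cancel the Ricci form of \<open>R\<close>.\<close>

lemma weyl_ricci_flat:
  assumes R: "algebraic_curvature_tensor (R :: 'a::euclidean_space \<Rightarrow> _)" and dim: "DIM('a) = 4"
  shows "(\<Sum>b\<in>Basis. weyl_tensor R b y z b) = 0"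
proof -
  define r where "r x y = ricci_op R x \<bullet> y" for x y
  have sym: "r x y = r y x" for x y
    unfolding r_def by (rule ricci_op_sym[OF R])
  have eq: "weyl_tensor R b y z b = R b y z b
      + (scalar_curvature R / 6) * (y \<bullet> z - (y \<bullet> b) * (z \<bullet> b))
      - (r y z - r z b * (y \<bullet> b) + (y \<bullet> z) * r b b - r y b * (z \<bullet> b)) / 2"
    if "b \<in> Basis" for b
  proof -
    have "b \<bullet> b = 1" using that by simp
    then show ?thesis
      unfolding weyl_tensor_eq[OF R dim, folded r_def] sym[of b z] inner_commute[of b y]
        inner_commute[of b z] by algebra
  qed
  have 1: "(\<Sum>b\<in>Basis. R b y z b) = r y z"
    by (simp add: r_def ricci_op_inner[OF R])
  have 2: "(\<Sum>b\<in>Basis. (y \<bullet> b) * (z \<bullet> b)) = y \<bullet> z"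
    by (rule euclidean_inner[symmetric])
  have 3: "(\<Sum>b\<in>Basis. r u b * (v \<bullet> b)) = r u v" for u v
    unfolding r_def by (rule euclidean_inner[symmetric])
  have 4: "(\<Sum>b\<in>Basis. r b b) = scalar_curvature R"
    by (simp add: r_def scalar_curvature_def Tr_def)
  have "(\<Sum>b\<in>Basis. weyl_tensor R b y z b) = (\<Sum>b\<in>Basis. R b y z b
      + (scalar_curvature R / 6) * (y \<bullet> z - (y \<bullet> b) * (z \<bullet> b))
      - (r y z - r z b * (y \<bullet> b) + (y \<bullet> z) * r b b - r y b * (z \<bullet> b)) / 2)"
    by (intro sum.cong refl eq)
  also have "\<dots> = (\<Sum>b\<in>Basis. R b y z b)
      + (scalar_curvature R / 6) * ((\<Sum>b::'a\<in>Basis. y \<bullet> z) - (\<Sum>b\<in>Basis. (y \<bullet> b) * (z \<bullet> b)))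
      - ((\<Sum>b::'a\<in>Basis. r y z) - (\<Sum>b\<in>Basis. r z b * (y \<bullet> b))
        + (y \<bullet> z) * (\<Sum>b\<in>Basis. r b b) - (\<Sum>b\<in>Basis. r y b * (z \<bullet> b))) / 2"
    by (simp only: sum.distrib sum_subtractf sum_distrib_left[symmetric]
        sum_divide_distrib[symmetric])
  also have "\<dots> = 0"
    unfolding 1 2 3 4 by (simp add: dim sym[of z y] field_simps)
  finally show ?thesis .
qed

section \<open>Self-dual and anti-self-dual forms in a frame\<close>

definition wedge_op :: "'a::real_inner \<Rightarrow> 'a \<Rightarrow> 'a \<Rightarrow> 'a" where
  "wedge_op u v x = (x \<bullet> u) *\<^sub>R v - (x \<bullet> v) *\<^sub>R u"

lemma wedge_op_inner: "wedge_op u v x \<bullet> y = wedge (inner u) (inner v) x y"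
  by (simp add: wedge_op_def wedge_def inner_diff_left inner_commute[of x] inner_commute[of y])

context frame4
begin

text \<open>With \<open>e 1\<close>, \<open>e 2\<close>, \<open>e 3\<close>, \<open>e 4\<close> read
  as 1, i, j, k, these are the left (\<open>s = 1\<close>) and right (\<open>s = -1\<close>)
  multiplications by i, j, k, whence \<open>sd_unit_commute\<close>. The order \<open>e 4\<close>,
  \<open>e 2\<close> makes all three index arrangements even permutations, so that one sign
  \<open>s\<close> serves throughout.\<close>

definition sd_unit :: "real \<Rightarrow> 3 \<Rightarrow> 'a \<Rightarrow> 'a" where
  "sd_unit s a x =
    (if a = 1 then wedge_op (e 1) (e 2) x + s *\<^sub>R wedge_op (e 3) (e 4) x
     else if a = 2 then wedge_op (e 1) (e 3) x + s *\<^sub>R wedge_op (e 4) (e 2) x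
     else wedge_op (e 1) (e 4) x + s *\<^sub>R wedge_op (e 2) (e 3) x)"

lemma eq_by_coords:
  assumes "x \<bullet> e 1 = y \<bullet> e 1" "x \<bullet> e 2 = y \<bullet> e 2" "x \<bullet> e 3 = y \<bullet> e 3" "x \<bullet> e 4 = y \<bullet> e 4"
  shows "x = y"
  by (rule eqI) (use assms exhaust_4 in metis)

lemma sd_unit_coord:
  "sd_unit s 1 x \<bullet> e 1 = - (x \<bullet> e 2)" "sd_unit s 1 x \<bullet> e 2 = x \<bullet> e 1"
  "sd_unit s 1 x \<bullet> e 3 = - s * (x \<bullet> e 4)" "sd_unit s 1 x \<bullet> e 4 = s * (x \<bullet> e 3)"
  "sd_unit s 2 x \<bullet> e 1 = - (x \<bullet> e 3)" "sd_unit s 2 x \<bullet> e 3 = x \<bullet> e 1"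
  "sd_unit s 2 x \<bullet> e 4 = - s * (x \<bullet> e 2)" "sd_unit s 2 x \<bullet> e 2 = s * (x \<bullet> e 4)"
  "sd_unit s 3 x \<bullet> e 1 = - (x \<bullet> e 4)" "sd_unit s 3 x \<bullet> e 4 = x \<bullet> e 1"
  "sd_unit s 3 x \<bullet> e 2 = - s * (x \<bullet> e 3)" "sd_unit s 3 x \<bullet> e 3 = s * (x \<bullet> e 2)"
  by (simp_all add: sd_unit_def wedge_op_def inner_add_left inner_diff_left inner_e)

lemma sd_unit_inner:
  "sd_unit s 1 x \<bullet> y = wedge (inner (e 1)) (inner (e 2)) x y + s * wedge (inner (e 3)) (inner (e 4)) x y"
  "sd_unit s 2 x \<bullet> y = wedge (inner (e 1)) (inner (e 3)) x y + s * wedge (inner (e 4)) (inner (e 2)) x y"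
  "sd_unit s 3 x \<bullet> y = wedge (inner (e 1)) (inner (e 4)) x y + s * wedge (inner (e 2)) (inner (e 3)) x y"
  by (simp_all add: sd_unit_def inner_add_left wedge_op_inner)

lemma linear_H: "linear (sd_unit s a)"
  by (rule linearI)
    (simp_all add: sd_unit_def wedge_op_def inner_add_left algebra_simps)

lemma sd_unit_skew: "sd_unit s a x \<bullet> y = - (x \<bullet> sd_unit s a y)"
  by (simp add: sd_unit_def wedge_op_inner inner_add_left inner_add_right wedge_def inner_commute[of x] algebra_simps)

lemma sd_unit_quaternion:
  assumes "s * s = 1"
  shows "sd_unit s a (sd_unit s b x) + sd_unit s b (sd_unit s a x) = (- 2 * (if a = b then 1 else 0)) *\<^sub>R x"
proof -
  have s: "s * (s * t) = t" for t by (simp add: mult.assoc[symmetric] assms)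
  have "\<forall>a b. sd_unit s a (sd_unit s b x) + sd_unit s b (sd_unit s a x) = (- 2 * (if a = b then 1 else 0)) *\<^sub>R x"
    unfolding forall_3 by (intro conjI; rule eq_by_coords; simp add: inner_add_left sd_unit_coord s)
  then show ?thesis by blast
qed

lemma sd_unit_commute:
  assumes "s * s = 1"
  shows "sd_unit s a (sd_unit (- s) b x) = sd_unit (- s) b (sd_unit s a x)"
proof -
  have s: "s * (s * t) = t" for t by (simp add: mult.assoc[symmetric] assms)
  have "\<forall>a b. sd_unit s a (sd_unit (- s) b x) = sd_unit (- s) b (sd_unit s a x)"
    unfolding forall_3 by (intro conjI; rule eq_by_coords; simp add: sd_unit_coord s)
  then show ?thesis by blast
qed

end

section \<open>Spectral theorem for symmetric matrices of size three\<close>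

text \<open>A maximum of the Rayleigh quotient on the unit sphere of \<open>S\<close> is an
  eigenvector. Working in an invariant subspace allows eigenvectors to be split off one by
  one.\<close>

lemma self_adjoint_eigenvector:
  fixes T :: "'b::euclidean_space \<Rightarrow> 'b"
  assumes T: "linear T" and adj: "\<And>x y. T x \<bullet> y = x \<bullet> T y"
    and S: "subspace S" "\<And>x. x \<in> S \<Longrightarrow> T x \<in> S" and nz: "w \<in> S" "w \<noteq> 0"
  obtains v \<mu> where "v \<in> S" "v \<bullet> v = 1" "T v = \<mu> *\<^sub>R v"
proof -
  let ?K = "S \<inter> sphere 0 1"
  have "compact ?K"
    using closed_subspace[OF S(1)] compact_sphere[of "0::'b" 1] by (rule closed_Int_compact)
  moreover have "(1 / norm w) *\<^sub>R w \<in> ?K"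
    using nz S(1) by (auto intro: subspace_scale)
  moreover have "continuous_on ?K (\<lambda>x. x \<bullet> T x)"
    by (intro continuous_intros linear_continuous_on linear_conv_bounded_linear[THEN iffD1] T)
  ultimately obtain v where v: "v \<in> ?K" and sup: "\<And>x. x \<in> ?K \<Longrightarrow> x \<bullet> T x \<le> v \<bullet> T v"
    using continuous_attains_sup[of ?K "\<lambda>x. x \<bullet> T x"] by blast
  define \<mu> where "\<mu> = v \<bullet> T v"
  \<comment> \<open>\<open>q\<close> is a quadratic form, nonnegative on \<open>S\<close> and zero
    at \<open>v\<close>, so its first variation at \<open>v\<close> vanishes; below it is tested in
    the direction of the residual \<open>\<mu> *\<^sub>R v - T v\<close>.\<close>
  define q where "q x = \<mu> * (x \<bullet> x) - x \<bullet> T x" for x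
  have vv: "v \<bullet> v = 1" and vS: "v \<in> S" using v by (auto simp: norm_eq_1)
  have q: "q x \<ge> 0" if x: "x \<in> S" for x
  proof (cases "x = 0")
    case True
    then show ?thesis by (simp add: q_def)
  next
    case False
    define y where "y = (1 / norm x) *\<^sub>R x"
    have "y \<in> ?K" using False S(1) x by (auto simp: y_def intro: subspace_scale)
    from sup[OF this] have "x \<bullet> T x / (norm x)\<^sup>2 \<le> \<mu>"
      by (simp add: y_def \<mu>_def linear_scale[OF T] power2_eq_square)
    then show ?thesis
      using False by (simp add: q_def power2_norm_eq_inner divide_le_eq)
  qed
  define w where "w = \<mu> *\<^sub>R v - T v"
  have wS: "w \<in> S"
    unfolding w_def using S vS by (intro subspace_diff subspace_scale) auto
  have exp: "q (v + t *\<^sub>R w) = 2 * t * (w \<bullet> w) + t\<^sup>2 * q w" for t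
  proof -
    have a: "v \<bullet> T w = T v \<bullet> w" "w \<bullet> T v = T v \<bullet> w" by (metis adj inner_commute)+
    have b: "w \<bullet> w = \<mu> * (v \<bullet> w) - T v \<bullet> w"
      by (subst (1) w_def) (simp add: inner_diff_left)
    show ?thesis
      unfolding q_def b
      by (simp add: linear_add[OF T] linear_scale[OF T] inner_add_left inner_add_right a
          inner_commute[of w v] vv \<mu>_def[symmetric] power2_eq_square algebra_simps)
        (simp add: b \<mu>_def[symmetric] algebra_simps)
  qed
  have pos: "0 \<le> 2 * t * (w \<bullet> w) + t\<^sup>2 * q w" for t
    unfolding exp[symmetric] using S(1) vS wS by (intro q subspace_add subspace_scale)
  \<comment> \<open>The bound is a parabola in \<open>t\<close> with slope
    \<open>2 * (w \<bullet> w)\<close> at 0. If it degenerates to a line, \<open>t = -1\<close>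
    suffices; otherwise its minimum, at \<open>- (w \<bullet> w) / q w\<close>, would be negative
    for nonzero \<open>w\<close>.\<close>
  have "w \<bullet> w = 0"
  proof (cases "q w = 0")
    case True
    then show ?thesis using pos[of "-1"] inner_ge_zero[of w] by simp
  next
    case False
    then have "q w > 0" using q[OF wS] by simp
    then have "0 \<le> - ((w \<bullet> w)\<^sup>2 / q w)"
      using pos[of "- (w \<bullet> w) / q w"] by (simp add: power2_eq_square field_simps)
    then have "(w \<bullet> w)\<^sup>2 \<le> 0" using \<open>q w > 0\<close> by (simp add: field_simps)
    then show ?thesis by simp
  qed
  then have "T v = \<mu> *\<^sub>R v" by (simp add: w_def)
  with vS vv show ?thesis by (rule that)
qed

text \<open>Each new eigenvector is found in the orthogonal complement of the earlier ones, which is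
  invariant by self-adjointness; the eigenvectors become the rows of \<open>V\<close>.\<close>

lemma symmetric_matrix_diagonalization_3:
  fixes A :: "real^3^3"
  assumes sym: "transpose A = A"
  obtains V :: "real^3^3" and l :: "3 \<Rightarrow> real"
  where "orthogonal_matrix V" "\<And>a b. A $ a $ b = (\<Sum>k\<in>UNIV. l k * V $ k $ a * V $ k $ b)"
proof -
  let ?T = "\<lambda>x. A *v x"
  have T: "linear ?T" by simp
  have adj: "?T x \<bullet> y = x \<bullet> ?T y" for x y
    by (metis dot_lmul_matrix sym transpose_matrix_vector)
  obtain v1 \<mu>1 where v1: "v1 \<bullet> v1 = 1" "?T v1 = \<mu>1 *\<^sub>R v1"
    using self_adjoint_eigenvector[OF T adj, of UNIV "axis 1 1"] by auto
  obtain w2 :: "real^3" where "w2 \<noteq> 0" "orthogonal v1 w2"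
    using orthogonal_to_vector_exists[of v1] by auto
  moreover have "subspace {x. v1 \<bullet> x = 0}" by (rule subspace_hyperplane)
  moreover have "v1 \<bullet> ?T x = 0" if "v1 \<bullet> x = 0" for x
    using that by (simp add: adj[symmetric] v1)
  ultimately obtain v2 \<mu>2 where v2: "v1 \<bullet> v2 = 0" "v2 \<bullet> v2 = 1" "?T v2 = \<mu>2 *\<^sub>R v2"
    using self_adjoint_eigenvector[OF T adj, of "{x. v1 \<bullet> x = 0}" w2]
    by (auto simp: orthogonal_def)
  have "dim (span {v1, v2}) < DIM(real^3)"
    using dim_le_card[of "span {v1, v2}" "{v1, v2}"] card_insert_le_m1[of 2 "{v2}" v1] by simp
  then obtain w3 where "w3 \<noteq> 0" "v1 \<bullet> w3 = 0" "v2 \<bullet> w3 = 0"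
    using orthogonal_to_subspace_exists[of "span {v1, v2}"]
    by (metis insertCI orthogonal_def span_base span_span inner_commute)
  moreover have "subspace ({x. v1 \<bullet> x = 0} \<inter> {x. v2 \<bullet> x = 0})"
    by (intro subspace_inter subspace_hyperplane)
  moreover have "v1 \<bullet> ?T x = 0 \<and> v2 \<bullet> ?T x = 0" if "v1 \<bullet> x = 0" "v2 \<bullet> x = 0" for x
    using that by (simp add: adj[symmetric] v1 v2)
  ultimately obtain v3 \<mu>3 where v3: "v1 \<bullet> v3 = 0" "v2 \<bullet> v3 = 0" "v3 \<bullet> v3 = 1"
      "?T v3 = \<mu>3 *\<^sub>R v3"
    using self_adjoint_eigenvector[OF T adj, of "{x. v1 \<bullet> x = 0} \<inter> {x. v2 \<bullet> x = 0}" w3]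
    by simp metis
  define V :: "real^3^3" where "V = vector [v1, v2, v3]"
  define l :: "3 \<Rightarrow> real" where "l k = (if k = 1 then \<mu>1 else if k = 2 then \<mu>2 else \<mu>3)" for k
  have V: "V $ 1 = v1" "V $ 2 = v2" "V $ 3 = v3" by (simp_all add: V_def)
  have orth: "\<forall>k j. V $ k \<bullet> V $ j = (if k = j then 1 else 0)"
    unfolding forall_3 V by (simp add: v1 v2 v3 inner_commute)
  have eig: "\<forall>k. ?T (V $ k) = l k *\<^sub>R V $ k"
    unfolding forall_3 V by (simp add: v1 v2 v3 l_def)
  have "V ** transpose V = mat 1"
    using orth by (simp add: vec_eq_iff matrix_matrix_mult_def transpose_def mat_def inner_vec_def)
  then have V1: "orthogonal_matrix V"
    by (simp add: orthogonal_matrix_def matrix_left_right_inverse)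
  \<comment> \<open>This completeness relation recovers the entries of \<open>A\<close> from its
    action on the rows of \<open>V\<close>.\<close>
  then have "transpose V ** V = mat 1" by (simp add: orthogonal_matrix_def)
  then have V2: "(\<Sum>k\<in>UNIV. V $ k $ c * V $ k $ b) = (if c = b then 1 else 0)" for c b
    by (simp add: vec_eq_iff matrix_matrix_mult_def transpose_def mat_def)
  have "A $ a $ b = (\<Sum>k\<in>UNIV. l k * V $ k $ a * V $ k $ b)" for a b
  proof -
    have "(\<Sum>k\<in>UNIV. l k * V $ k $ a * V $ k $ b) = (\<Sum>k\<in>UNIV. ?T (V $ k) $ a * V $ k $ b)"
      using eig by simp
    also have "\<dots> = (\<Sum>c\<in>UNIV. A $ a $ c * (\<Sum>k\<in>UNIV. V $ k $ c * V $ k $ b))"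
      unfolding matrix_vector_mult_def sum_distrib_left
      by (subst sum.swap) (simp add: sum_distrib_right mult.assoc)
    also have "\<dots> = A $ a $ b"
      by (simp add: V2 if_distrib cong: if_cong)
    finally show ?thesis by simp
  qed
  with V1 show ?thesis by (rule that)
qed

section \<open>Two-forms and the Hodge star\<close>

text \<open>Peeling off 1, 2 and 3 in turn writes each permutation as a product of transpositions,
  which determines its sign and its values.\<close>

lemma sum_permutations_4:
  "(\<Sum>p | p permutes (UNIV :: 4 set). of_int (sign p) * f (p 1) (p 2) (p 3) (p 4)) =
    f 1 2 3 4 - f 1 2 4 3 - f 1 3 2 4 + f 1 3 4 2 + f 1 4 2 3 - f 1 4 3 2
  - f 2 1 3 4 + f 2 1 4 3 + f 2 3 1 4 - f 2 3 4 1 - f 2 4 1 3 + f 2 4 3 1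
  + f 3 1 2 4 - f 3 1 4 2 - f 3 2 1 4 + f 3 2 4 1 + f 3 4 1 2 - f 3 4 2 1
  - f 4 1 2 3 + f 4 1 3 2 + f 4 2 1 3 - f 4 2 3 1 - f 4 3 1 2 + (f 4 3 2 1 :: real)"
proof -
  have 1: "finite {2::4, 3, 4}" "1 \<notin> {2::4, 3, 4}"
    and 2: "finite {3::4, 4}" "2 \<notin> {3::4, 4}" and 3: "finite {4::4}" "3 \<notin> {4::4}"
    by auto
  show ?thesis
    unfolding UNIV_4
    unfolding sum_over_permutations_insert[OF 1] sum_over_permutations_insert[OF 2]
      sum_over_permutations_insert[OF 3] permutes_sing
    by (simp add: sign_swap_id permutation_swap_id permutation_compose sign_compose sign_id swap_id_eq)
qed

context frame4
begin

text \<open>Pairing of \<open>\<omega>\<close> with the form of \<open>sd_unit s a\<close>. That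
  form has squared length 2, so the coordinates of \<open>\<omega>\<close> are half of these
  numbers; the later factors 1/2 and 1/4 come from here.\<close>

definition sd_coeff :: "real \<Rightarrow> ('a \<Rightarrow> 'a \<Rightarrow> real) \<Rightarrow> 3 \<Rightarrow> real" where
  "sd_coeff s \<omega> a =
    (if a = 1 then \<omega> (e 1) (e 2) + s * \<omega> (e 3) (e 4)
     else if a = 2 then \<omega> (e 1) (e 3) + s * \<omega> (e 4) (e 2)
     else \<omega> (e 1) (e 4) + s * \<omega> (e 2) (e 3))"

lemma two_formD:
  assumes "\<omega> \<in> two_forms"
  shows "linear (\<lambda>x. \<omega> x y)" "linear (\<lambda>y. \<omega> x y)" "\<omega> x y = - \<omega> y x" "\<omega> x x = 0"
proof -
  show "linear (\<lambda>x. \<omega> x y)" "linear (\<lambda>y. \<omega> x y)"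
    using assms unfolding two_forms_def bilinear_def by blast+
  show *: "\<omega> x y = - \<omega> y x" for x y
    using assms unfolding two_forms_def by blast
  show "\<omega> x x = 0" using *[of x x] by linarith
qed

lemma two_form_frame_expand:
  assumes "\<omega> \<in> two_forms"
  shows "\<omega> x y =
      \<omega> (e 1) (e 2) * wedge (inner (e 1)) (inner (e 2)) x y
    + \<omega> (e 1) (e 3) * wedge (inner (e 1)) (inner (e 3)) x y
    + \<omega> (e 1) (e 4) * wedge (inner (e 1)) (inner (e 4)) x y
    + \<omega> (e 2) (e 3) * wedge (inner (e 2)) (inner (e 3)) x y
    + \<omega> (e 4) (e 2) * wedge (inner (e 4)) (inner (e 2)) x y
    + \<omega> (e 3) (e 4) * wedge (inner (e 3)) (inner (e 4)) x y"
proof -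
  note D = two_formD[OF assms]
  have "\<omega> x y = (\<Sum>i\<in>UNIV. (x \<bullet> e i) *\<^sub>R \<omega> (e i) y)"
    by (rule linear_expand[OF D(1)])
  also have "\<dots> = (\<Sum>i\<in>UNIV. (x \<bullet> e i) *\<^sub>R (\<Sum>j\<in>UNIV. (y \<bullet> e j) *\<^sub>R \<omega> (e i) (e j)))"
    by (intro sum.cong refl arg_cong[of _ _ "scaleR _"] linear_expand[OF D(2)])
  finally show ?thesis
    unfolding sum_4
    by (simp add: D(4) D(3)[of "e 2" "e 1"] D(3)[of "e 3" "e 1"] D(3)[of "e 4" "e 1"]
        D(3)[of "e 3" "e 2"] D(3)[of "e 2" "e 4"] D(3)[of "e 4" "e 3"]
        wedge_def inner_commute[of x] inner_commute[of y] algebra_simps)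
qed

lemma two_form_sd_expand:
  assumes "\<omega> \<in> two_forms"
  shows "\<omega> x y = (\<Sum>a\<in>UNIV. sd_coeff 1 \<omega> a * (sd_unit 1 a x \<bullet> y)) / 2
    + (\<Sum>a\<in>UNIV. sd_coeff (-1) \<omega> a * (sd_unit (-1) a x \<bullet> y)) / 2"
  unfolding two_form_frame_expand[OF assms, of x y] sum_3 sd_coeff_def sd_unit_inner
  by (simp add: algebra_simps add_divide_distrib diff_divide_distrib)

lemma sd_unit_two_form: "(\<lambda>x y. sd_unit s a x \<bullet> y) \<in> two_forms"
proof -
  have "bilinear (\<lambda>x y. sd_unit s a x \<bullet> y)"
    by (intro bilinearI linearI)
      (simp_all add: linear_add[OF linear_H] linear_scale[OF linear_H] inner_add_left inner_add_right)
  moreover have "sd_unit s a x \<bullet> y = - (sd_unit s a y \<bullet> x)" for x y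
    using sd_unit_skew[of s a x y] by (simp only: inner_commute)
  ultimately show ?thesis unfolding two_forms_def by blast
qed

lemma sd_coeff_unit:
  assumes "s = 1 \<or> s = -1" "t = 1 \<or> t = -1"
  shows "sd_coeff s (\<lambda>x y. sd_unit t b x \<bullet> y) a = (if s = t \<and> a = b then 2 else 0)"
proof -
  have "\<forall>a b. sd_coeff s (\<lambda>x y. sd_unit t b x \<bullet> y) a = (if s = t \<and> a = b then 2 else 0)"
    using assms unfolding forall_3 by (auto simp: sd_coeff_def sd_unit_coord inner_e)
  then show ?thesis by blast
qed

lemma hodge_star_eq:
  assumes "\<omega> \<in> two_forms" and "oriented_frame \<O> = e"
  shows "hodge_star \<O> \<omega> x y =
      \<omega> (e 1) (e 2) * wedge (inner (e 3)) (inner (e 4)) x y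
    + \<omega> (e 1) (e 3) * wedge (inner (e 4)) (inner (e 2)) x y
    + \<omega> (e 1) (e 4) * wedge (inner (e 2)) (inner (e 3)) x y
    + \<omega> (e 2) (e 3) * wedge (inner (e 1)) (inner (e 4)) x y
    + \<omega> (e 4) (e 2) * wedge (inner (e 1)) (inner (e 3)) x y
    + \<omega> (e 3) (e 4) * wedge (inner (e 1)) (inner (e 2)) x y"
proof -
  define w where "w i j = wedge (inner (e i)) (inner (e j)) x y" for i j
  note sk = two_formD(3)[OF assms(1)]
  have w: "w i j = - w j i" for i j by (simp add: w_def wedge_def)
  have "hodge_star \<O> \<omega> x y = (1/4) * (\<Sum>p | p permutes (UNIV :: 4 set).
      of_int (sign p) * (\<omega> (e (p 1)) (e (p 2)) * w (p 3) (p 4)))"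
    by (simp add: hodge_star_def assms(2) w_def mult.assoc)
  also have "\<dots> = \<omega> (e 1) (e 2) * w 3 4 + \<omega> (e 1) (e 3) * w 4 2 + \<omega> (e 1) (e 4) * w 2 3
    + \<omega> (e 2) (e 3) * w 1 4 + \<omega> (e 4) (e 2) * w 1 3 + \<omega> (e 3) (e 4) * w 1 2"
    unfolding sum_permutations_4[of "\<lambda>i j k l. \<omega> (e i) (e j) * w k l"]
    by (simp add: sk[of "e 2" "e 1"] sk[of "e 3" "e 1"] sk[of "e 4" "e 1"]
        sk[of "e 3" "e 2"] sk[of "e 2" "e 4"] sk[of "e 4" "e 3"]
        w[of 2 1] w[of 3 1] w[of 4 1] w[of 3 2] w[of 2 4] w[of 4 3])
  finally show ?thesis by (simp add: w_def)
qed

lemma wedge_e: "wedge (inner (e i)) (inner (e j)) (e k) (e l) =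
    (if i = k \<and> j = l then 1 else 0) - (if i = l \<and> j = k then 1 else 0)"
  unfolding wedge_def inner_e by (cases "i = k"; cases "i = l"; cases "j = l"; cases "j = k") simp_all

lemma hodge_star_unit:
  assumes "s * s = 1" and "oriented_frame \<O> = e"
  shows "hodge_star \<O> (\<lambda>x y. sd_unit s a x \<bullet> y) x y = s * (sd_unit s a x \<bullet> y)"
proof -
  have s: "s * (s * t) = t" for t by (simp add: mult.assoc[symmetric] assms)
  have "\<forall>a. hodge_star \<O> (\<lambda>x y. sd_unit s a x \<bullet> y) x y = s * (sd_unit s a x \<bullet> y)"
    unfolding hodge_star_eq[OF sd_unit_two_form assms(2)] forall_3 sd_unit_inner wedge_e
    by (simp add: s distrib_left)
  then show ?thesis by blast
qed

text \<open>The star exchanges components on complementary index pairs, so an eigenform satisfies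
  \<open>\<omega> (e 3) (e 4) = s * \<omega> (e 1) (e 2)\<close> and its two analogues, and the
  combinations with \<open>-s\<close> cancel.\<close>

lemma hodge_eigen_coeff:
  assumes "\<omega> \<in> two_forms" "oriented_frame \<O> = e" "s * s = 1"
    and "\<And>x y. hodge_star \<O> \<omega> x y = s * \<omega> x y"
  shows "sd_coeff (-s) \<omega> a = 0"
proof -
  have s: "s * (s * t) = t" for t by (simp add: mult.assoc[symmetric] assms)
  have *: "s * \<omega> (e 1) (e 2) = \<omega> (e 3) (e 4)" "s * \<omega> (e 1) (e 3) = \<omega> (e 4) (e 2)"
    "s * \<omega> (e 1) (e 4) = \<omega> (e 2) (e 3)"
    by (simp_all add: assms(4)[symmetric] hodge_star_eq[OF assms(1,2)] wedge_def inner_e)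
  show ?thesis
    by (simp add: sd_coeff_def *[symmetric] s)
qed

end

section \<open>Quaternionic decomposition of a Ricci-flat curvature tensor\<close>

lemma curvature_two_forms:
  assumes W: "algebraic_curvature_tensor W"
  shows "(\<lambda>x y. W x y z w) \<in> two_forms" "(\<lambda>z w. W x y z w) \<in> two_forms"
proof -
  show "(\<lambda>x y. W x y z w) \<in> two_forms"
    unfolding two_forms_def mem_Collect_eq
    by (intro conjI allI bilinearI curvature_tensorD[OF W])
  have "W x y z w = - W x y w z" for z w
    using curvature_tensorD(5,6)[OF W] by metis
  then show "(\<lambda>z w. W x y z w) \<in> two_forms"
    unfolding two_forms_def mem_Collect_eq
    by (intro conjI allI bilinearI curvature_tensorD[OF W])
qed

definition quaternionic :: "(3 \<Rightarrow> 'a::real_inner \<Rightarrow> 'a) \<Rightarrow> bool" where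
  "quaternionic \<Phi> \<longleftrightarrow> (\<forall>i. skew_adjoint (\<Phi> i)) \<and>
     (\<forall>i j x. \<Phi> i (\<Phi> j x) + \<Phi> j (\<Phi> i x) = (- 2 * (if i = j then 1 else 0)) *\<^sub>R x)"

context frame4
begin

text \<open>Block of \<open>W\<close> as a bilinear form on two-forms: \<open>s\<close> and
  \<open>t\<close> select the Hodge eigenspaces for the first and the second index pair.\<close>

definition sd_block :: "('a \<Rightarrow> 'a \<Rightarrow> 'a \<Rightarrow> 'a \<Rightarrow> real) \<Rightarrow> real \<Rightarrow> real \<Rightarrow> 3 \<Rightarrow> 3 \<Rightarrow> real" where
  "sd_block W s t a b = sd_coeff s (\<lambda>x y. sd_coeff t (\<lambda>z w. W x y z w) b) a"

lemma sd_block_sym: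
  assumes W: "algebraic_curvature_tensor W"
  shows "sd_block W s t a b = sd_block W t s b a"
  using curvature_tensorD(6)[OF W] by (simp add: sd_block_def sd_coeff_def algebra_simps)

text \<open>Each mixed entry is a combination of Ricci components. In the trace of a diagonal block,
  the terms on equal index pairs add up to a multiple of the trace of Ricci, and the cross terms to
  a multiple of the Bianchi sum.\<close>

lemma curvature_frame_relations:
  assumes W: "algebraic_curvature_tensor W"
    and flat: "\<And>y z. (\<Sum>b\<in>Basis. W b y z b) = 0"
  shows "sd_block W 1 (-1) a b = 0"
    and "(\<Sum>a\<in>UNIV. sd_block W 1 1 a a) = 0" "(\<Sum>a\<in>UNIV. sd_block W (-1) (-1) a a) = 0"
proof -
  define w where "w i j k l = W (e i) (e j) (e k) (e l)" for i j k l
  have anti1: "w i j k l = - w j i k l" and anti2: "w i j k l = - w i j l k"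
    and pair: "w i j k l = w k l i j" for i j k l
    unfolding w_def using curvature_tensorD(5,6)[OF W] by metis+
  have diag: "w i i k l = 0" "w i j k k = 0" for i j k l
    using anti1[of i i k l] anti2[of i j k k] by linarith+
  \<comment> \<open>These instances form a terminating rewrite system: index pairs become 12, 13,
    14, 23, 42 or 34, and the two pairs of a component are put in that order.\<close>
  note n = diag
    anti1[of 2 1] anti1[of 3 1] anti1[of 4 1] anti1[of 3 2] anti1[of 2 4] anti1[of 4 3]
    anti2[of _ _ 2 1] anti2[of _ _ 3 1] anti2[of _ _ 4 1] anti2[of _ _ 3 2] anti2[of _ _ 2 4]
    anti2[of _ _ 4 3]
    pair[of 1 3 1 2] pair[of 1 4 1 2] pair[of 2 3 1 2] pair[of 4 2 1 2] pair[of 3 4 1 2]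
    pair[of 1 4 1 3] pair[of 2 3 1 3] pair[of 4 2 1 3] pair[of 3 4 1 3]
    pair[of 2 3 1 4] pair[of 4 2 1 4] pair[of 3 4 1 4]
    pair[of 4 2 2 3] pair[of 3 4 2 3] pair[of 3 4 4 2]
  have ric: "w 1 j k 1 + w 2 j k 2 + w 3 j k 3 + w 4 j k 4 = 0" for j k
  proof -
    have "bilinear (\<lambda>x y. W x (e j) (e k) y)"
      by (intro bilinearI curvature_tensorD[OF W])
    from trace_frame[OF this] show ?thesis
      by (simp add: flat sum_4 w_def)
  qed
  note ric_comp = ric[of 1 1] ric[of 1 2] ric[of 1 3] ric[of 1 4] ric[of 2 2] ric[of 2 3] ric[of 2 4]
    ric[of 3 3] ric[of 3 4] ric[of 4 4]
  have bianchi: "w 1 2 3 4 + w 2 3 1 4 + w 3 1 2 4 = 0"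
    unfolding w_def by (rule curvature_tensorD(7)[OF W])
  have "\<forall>a b. sd_block W 1 (-1) a b = 0"
    using ric_comp unfolding forall_3
    by (simp add: sd_block_def sd_coeff_def w_def[symmetric] n)
  then show "sd_block W 1 (-1) a b = 0" by blast
  show "(\<Sum>a\<in>UNIV. sd_block W 1 1 a a) = 0" "(\<Sum>a\<in>UNIV. sd_block W (-1) (-1) a a) = 0"
    using ric_comp bianchi unfolding sum_3
    by (simp_all add: sd_block_def sd_coeff_def w_def[symmetric] n)
qed

lemma two_forms_sd_coeff:
  assumes "\<And>z w. (\<lambda>x y. F x y z w) \<in> two_forms"
  shows "(\<lambda>x y. sd_coeff t (\<lambda>z w. F x y z w) b) \<in> two_forms"
proof -
  have lin: "linear (\<lambda>x. F x y z w)" "linear (\<lambda>y. F x y z w)" and anti: "F x y z w = - F y x z w"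
    for x y z w
    using two_formD[OF assms[of z w]] by blast+
  have "bilinear (\<lambda>x y. sd_coeff t (\<lambda>z w. F x y z w) b)"
    by (intro bilinearI linearI)
      (simp_all add: sd_coeff_def linear_add[OF lin(1)] linear_add[OF lin(2)]
        linear_scale[OF lin(1)] linear_scale[OF lin(2)] algebra_simps)
  moreover have "sd_coeff t (\<lambda>z w. F x y z w) b = - sd_coeff t (\<lambda>z w. F y x z w) b" for x y
    unfolding anti[of x y] by (simp add: sd_coeff_def)
  ultimately show ?thesis unfolding two_forms_def by blast
qed

text \<open>Pairing the last two slots with one eigenspace leaves a two-form in \<open>x\<close>,
  \<open>y\<close>; as the mixed blocks vanish, it lies in the same eigenspace.\<close>

lemma sd_coeff_curvature:
  assumes W: "algebraic_curvature_tensor W"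
    and flat: "\<And>y z. (\<Sum>b\<in>Basis. W b y z b) = 0"
    and t: "t = 1 \<or> t = -1"
  shows "sd_coeff t (\<lambda>z w. W x y z w) b = (\<Sum>a\<in>UNIV. sd_block W t t a b * (sd_unit t a x \<bullet> y)) / 2"
proof -
  have 1: "sd_block W 1 (-1) a b = 0" and 2: "sd_block W (-1) 1 a b = 0" for a b
    using curvature_frame_relations(1)[OF W flat] sd_block_sym[OF W, of "-1" 1] by simp_all
  have "sd_coeff t (\<lambda>z w. W x y z w) b = (\<Sum>a\<in>UNIV. sd_block W 1 t a b * (sd_unit 1 a x \<bullet> y)) / 2
    + (\<Sum>a\<in>UNIV. sd_block W (-1) t a b * (sd_unit (-1) a x \<bullet> y)) / 2"
    unfolding sd_block_def
    by (rule two_form_sd_expand[OF two_forms_sd_coeff[OF curvature_two_forms(1)[OF W]]])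
  then show ?thesis using t 1 2 by auto
qed

text \<open>Expanding each index pair contributes a factor 1/2, hence the 1/4.\<close>

lemma curvature_sd_expand:
  assumes W: "algebraic_curvature_tensor W"
    and flat: "\<And>y z. (\<Sum>b\<in>Basis. W b y z b) = 0"
  shows "W x y z w =
      (\<Sum>a\<in>UNIV. \<Sum>b\<in>UNIV. sd_block W 1 1 a b * (sd_unit 1 a x \<bullet> y) * (sd_unit 1 b z \<bullet> w)) / 4
    + (\<Sum>a\<in>UNIV. \<Sum>b\<in>UNIV. sd_block W (-1) (-1) a b * (sd_unit (-1) a x \<bullet> y) * (sd_unit (-1) b z \<bullet> w)) / 4"
proof -
  have "W x y z w = (\<Sum>b\<in>UNIV. sd_coeff 1 (\<lambda>z w. W x y z w) b * (sd_unit 1 b z \<bullet> w)) / 2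
    + (\<Sum>b\<in>UNIV. sd_coeff (-1) (\<lambda>z w. W x y z w) b * (sd_unit (-1) b z \<bullet> w)) / 2"
    by (rule two_form_sd_expand[OF curvature_two_forms(2)[OF W]])
  also have "\<dots> = (\<Sum>b\<in>UNIV. \<Sum>a\<in>UNIV. sd_block W 1 1 a b * (sd_unit 1 a x \<bullet> y) * (sd_unit 1 b z \<bullet> w)) / 4
    + (\<Sum>b\<in>UNIV. \<Sum>a\<in>UNIV. sd_block W (-1) (-1) a b * (sd_unit (-1) a x \<bullet> y) * (sd_unit (-1) b z \<bullet> w)) / 4"
    by (simp add: sd_coeff_curvature[OF assms] sum_distrib_right sum_divide_distrib[symmetric])
  finally show ?thesis
    by (subst (asm) (1 2) sum.swap)
qed

lemma sd_coeff_curvature_zero_iff: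
  assumes W: "algebraic_curvature_tensor W"
    and flat: "\<And>y z. (\<Sum>b\<in>Basis. W b y z b) = 0"
    and s: "s = 1 \<or> s = -1"
  shows "(\<forall>a z w. sd_coeff s (\<lambda>x y. W x y z w) a = 0) \<longleftrightarrow> (\<forall>a b. sd_block W s s a b = 0)"
proof -
  have pair: "sd_coeff s (\<lambda>x y. W x y z w) a = sd_coeff s (\<lambda>x y. W z w x y) a" for a z w
    by (simp add: sd_coeff_def curvature_tensorD(6)[OF W, of z w])
  show ?thesis
  proof (intro iffI allI)
    fix a b assume "\<forall>a z w. sd_coeff s (\<lambda>x y. W x y z w) a = 0"
    then have "sd_coeff s (\<lambda>z w. W x y z w) b = 0" for x y by (simp only: pair)
    then show "sd_block W s s a b = 0" by (simp add: sd_block_def sd_coeff_def[of _ "\<lambda>x y. 0"])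
  next
    fix a z w assume "\<forall>a b. sd_block W s s a b = 0"
    then show "sd_coeff s (\<lambda>x y. W x y z w) a = 0"
      unfolding pair sd_coeff_curvature[OF assms] by simp
  qed
qed

section \<open>Rotated quaternion units and diagonalization of the blocks\<close>

definition rotated_unit :: "real \<Rightarrow> real^3^3 \<Rightarrow> 3 \<Rightarrow> 'a \<Rightarrow> 'a" where
  "rotated_unit s V k x = (\<Sum>a\<in>UNIV. V $ k $ a *\<^sub>R sd_unit s a x)"

lemma linear_rotated_unit: "linear (rotated_unit s V k)"
  by (rule linearI)
    (simp_all add: rotated_unit_def linear_add[OF linear_H] linear_scale[OF linear_H]
      scaleR_add_right sum.distrib scaleR_sum_right mult.commute)

lemma orthogonal_matrix_rows:
  assumes "orthogonal_matrix (V :: real^'n^'n)"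
  shows "(\<Sum>a\<in>UNIV. V $ i $ a * V $ j $ a) = (if i = j then 1 else 0)"
    and "(\<Sum>k\<in>UNIV. V $ k $ i * V $ k $ j) = (if i = j then 1 else 0)"
proof -
  have "V ** transpose V = mat 1" "transpose V ** V = mat 1"
    using assms by (auto simp: orthogonal_matrix_def)
  then show "(\<Sum>a\<in>UNIV. V $ i $ a * V $ j $ a) = (if i = j then 1 else 0)"
    "(\<Sum>k\<in>UNIV. V $ k $ i * V $ k $ j) = (if i = j then 1 else 0)"
    by (simp_all add: vec_eq_iff matrix_matrix_mult_def transpose_def mat_def)
qed

lemma rotated_unit_apply2:
  "rotated_unit s V i (rotated_unit t U j x) = (\<Sum>a\<in>UNIV. \<Sum>b\<in>UNIV. (V $ i $ a * U $ j $ b) *\<^sub>R sd_unit s a (sd_unit t b x))"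
  by (simp add: rotated_unit_def linear_sum[OF linear_H] linear_scale[OF linear_H] scaleR_sum_right)

text \<open>The anticommutator is bilinear in the units, so for two rotated units it is -2 times the
  inner product of rows \<open>i\<close> and \<open>j\<close> of \<open>V\<close>.\<close>

lemma quaternionic_rotated_unit:
  assumes "s * s = 1" and V: "orthogonal_matrix V"
  shows "quaternionic (rotated_unit s V)"
proof -
  have "rotated_unit s V k x \<bullet> y = - (x \<bullet> rotated_unit s V k y)" for k x y
    by (simp add: rotated_unit_def inner_sum_left inner_sum_right sd_unit_skew[of s _ x y] sum_negf)
  moreover have "rotated_unit s V i (rotated_unit s V j x) + rotated_unit s V j (rotated_unit s V i x) =
      (- 2 * (if i = j then 1 else 0)) *\<^sub>R x" for i j x
  proof -
    have "rotated_unit s V i (rotated_unit s V j x) + rotated_unit s V j (rotated_unit s V i x)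
      = (\<Sum>a\<in>UNIV. \<Sum>b\<in>UNIV. (V $ i $ a * V $ j $ b) *\<^sub>R sd_unit s a (sd_unit s b x))
        + (\<Sum>a\<in>UNIV. \<Sum>b\<in>UNIV. (V $ i $ a * V $ j $ b) *\<^sub>R sd_unit s b (sd_unit s a x))"
      unfolding rotated_unit_apply2
      by (subst (3) sum.swap) (simp add: mult.commute)
    also have "\<dots> = (\<Sum>a\<in>UNIV. \<Sum>b\<in>UNIV. (V $ i $ a * V $ j $ b) *\<^sub>R (sd_unit s a (sd_unit s b x) + sd_unit s b (sd_unit s a x)))"
      by (simp add: sum.distrib scaleR_add_right)
    also have "\<dots> = (\<Sum>a\<in>UNIV. \<Sum>b\<in>UNIV. if b = a then (V $ i $ a * V $ j $ a * -2) *\<^sub>R x else 0)"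
      unfolding sd_unit_quaternion[OF assms(1)] by (intro sum.cong refl) auto
    also have "\<dots> = (\<Sum>a\<in>UNIV. V $ i $ a * V $ j $ a) *\<^sub>R (-2 *\<^sub>R x)"
      by (simp add: scaleR_sum_left[symmetric] sum_negf sum_distrib_right)
    finally show ?thesis by (simp add: orthogonal_matrix_rows(1)[OF V])
  qed
  ultimately show ?thesis
    by (auto simp: quaternionic_def skew_adjoint_def linear_rotated_unit)
qed

lemma rotated_unit_commute:
  assumes "s * s = 1"
  shows "rotated_unit s V i (rotated_unit (-s) U j x) = rotated_unit (-s) U j (rotated_unit s V i x)"
  unfolding rotated_unit_apply2 sd_unit_commute[OF assms]
  by (subst sum.swap) (simp add: mult.commute)

lemma sd_block_diagonalization:
  assumes W: "algebraic_curvature_tensor W"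
  obtains V l where "orthogonal_matrix V"
    "\<And>x y z w. (\<Sum>a\<in>UNIV. \<Sum>b\<in>UNIV. sd_block W s s a b * (sd_unit s a x \<bullet> y) * (sd_unit s b z \<bullet> w))
      = (\<Sum>k\<in>UNIV. l k * (rotated_unit s V k x \<bullet> y) * (rotated_unit s V k z \<bullet> w))"
    "(\<Sum>k\<in>UNIV. l k) = (\<Sum>a\<in>UNIV. sd_block W s s a a)"
    "(\<forall>a b. sd_block W s s a b = 0) \<longleftrightarrow> (\<forall>k. l k = 0)"
proof -
  define A :: "real^3^3" where "A = (\<chi> a b. sd_block W s s a b)"
  have "transpose A = A"
    using sd_block_sym[OF W, of s s] by (simp add: A_def transpose_def vec_eq_iff)
  then obtain V l where V: "orthogonal_matrix V"
    and A: "\<And>a b. A $ a $ b = (\<Sum>k\<in>UNIV. l k * V $ k $ a * V $ k $ b)"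
    by (rule symmetric_matrix_diagonalization_3) blast
  have B: "sd_block W s s a b = (\<Sum>k\<in>UNIV. l k * V $ k $ a * V $ k $ b)" for a b
    using A[of a b] by (simp add: A_def)
  \<comment> \<open>Arbitrary \<open>f\<close> and \<open>g\<close> allow evaluation both on the
    pairings with \<open>sd_unit\<close> and on the rows of \<open>V\<close>.\<close>
  have exp: "(\<Sum>a\<in>UNIV. \<Sum>b\<in>UNIV. sd_block W s s a b * f a * g b)
      = (\<Sum>k\<in>UNIV. l k * (\<Sum>a\<in>UNIV. V $ k $ a * f a) * (\<Sum>b\<in>UNIV. V $ k $ b * g b))" for f g
  proof -
    have "(\<Sum>a\<in>UNIV. \<Sum>b\<in>UNIV. sd_block W s s a b * f a * g b)
      = (\<Sum>a\<in>UNIV. \<Sum>b\<in>UNIV. \<Sum>k\<in>UNIV. l k * (V $ k $ a * f a) * (V $ k $ b * g b))"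
      unfolding B by (simp add: sum_distrib_left sum_distrib_right mult_ac)
    also have "\<dots> = (\<Sum>a\<in>UNIV. \<Sum>k\<in>UNIV. \<Sum>b\<in>UNIV. l k * (V $ k $ a * f a) * (V $ k $ b * g b))"
      by (intro sum.cong refl sum.swap)
    also have "\<dots> = (\<Sum>k\<in>UNIV. \<Sum>a\<in>UNIV. \<Sum>b\<in>UNIV. l k * (V $ k $ a * f a) * (V $ k $ b * g b))"
      by (rule sum.swap)
    also have "\<dots> = (\<Sum>k\<in>UNIV. \<Sum>b\<in>UNIV. \<Sum>a\<in>UNIV. l k * (V $ k $ a * f a) * (V $ k $ b * g b))"
      by (intro sum.cong refl sum.swap)
    finally show ?thesis by (simp add: sum_distrib_left sum_distrib_right)
  qed
  show ?thesis
  proof (rule that[OF V])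
    show "(\<Sum>a\<in>UNIV. \<Sum>b\<in>UNIV. sd_block W s s a b * (sd_unit s a x \<bullet> y) * (sd_unit s b z \<bullet> w))
      = (\<Sum>k\<in>UNIV. l k * (rotated_unit s V k x \<bullet> y) * (rotated_unit s V k z \<bullet> w))" for x y z w
      unfolding exp rotated_unit_def by (simp add: inner_sum_left)
    have "(\<Sum>a\<in>UNIV. sd_block W s s a a)
        = (\<Sum>k\<in>UNIV. l k * (\<Sum>a\<in>UNIV. V $ k $ a * V $ k $ a))"
      unfolding B by (subst sum.swap) (simp add: sum_distrib_left mult.assoc)
    then show "(\<Sum>k\<in>UNIV. l k) = (\<Sum>a\<in>UNIV. sd_block W s s a a)"
      by (simp add: orthogonal_matrix_rows(1)[OF V])
    \<comment> \<open>Evaluating the form on row \<open>j\<close> of \<open>V\<close> isolates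
      \<open>l j\<close>, since the rows are orthonormal.\<close>
    have "l j = 0" if "\<forall>a b. sd_block W s s a b = 0" for j
    proof -
      have "0 = (\<Sum>k\<in>UNIV. l k * (\<Sum>a\<in>UNIV. V $ k $ a * V $ j $ a) * (\<Sum>b\<in>UNIV. V $ k $ b * V $ j $ b))"
        unfolding exp[symmetric] using that by simp
      also have "\<dots> = (\<Sum>k\<in>UNIV. if k = j then l j else 0)"
        unfolding orthogonal_matrix_rows(1)[OF V] by (intro sum.cong) auto
      finally show ?thesis by simp
    qed
    then show "(\<forall>a b. sd_block W s s a b = 0) \<longleftrightarrow> (\<forall>k. l k = 0)"
      by (auto simp: B)
  qed
qed

proposition weyl_quaternionic_decomposition:
  assumes W: "algebraic_curvature_tensor W"
    and flat: "\<And>y z. (\<Sum>b\<in>Basis. W b y z b) = 0"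
  obtains \<Phi> \<Psi> \<alpha> \<beta> where "quaternionic \<Phi>" "quaternionic \<Psi>"
    "\<And>i j x. \<Phi> i (\<Psi> j x) = \<Psi> j (\<Phi> i x)"
    "(\<Sum>k\<in>UNIV. \<alpha> k) = 0" "(\<Sum>k\<in>UNIV. \<beta> k) = 0"
    "\<And>x y z w. W x y z w = (\<Sum>k\<in>UNIV. \<alpha> k * (\<Phi> k x \<bullet> y) * (\<Phi> k z \<bullet> w))
      + (\<Sum>k\<in>UNIV. \<beta> k * (\<Psi> k x \<bullet> y) * (\<Psi> k z \<bullet> w))"
    "(\<forall>a z w. sd_coeff 1 (\<lambda>x y. W x y z w) a = 0) \<longleftrightarrow> (\<forall>k. \<alpha> k = 0)"
    "(\<forall>a z w. sd_coeff (-1) (\<lambda>x y. W x y z w) a = 0) \<longleftrightarrow> (\<forall>k. \<beta> k = 0)"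
proof -
  obtain V l where V: "orthogonal_matrix V"
    "\<And>x y z w. (\<Sum>a\<in>UNIV. \<Sum>b\<in>UNIV. sd_block W 1 1 a b * (sd_unit 1 a x \<bullet> y) * (sd_unit 1 b z \<bullet> w))
      = (\<Sum>k\<in>UNIV. l k * (rotated_unit 1 V k x \<bullet> y) * (rotated_unit 1 V k z \<bullet> w))"
    "(\<Sum>k\<in>UNIV. l k) = (\<Sum>a\<in>UNIV. sd_block W 1 1 a a)"
    "(\<forall>a b. sd_block W 1 1 a b = 0) \<longleftrightarrow> (\<forall>k. l k = 0)"
    by (rule sd_block_diagonalization[OF W, of 1]) (rule that)
  obtain U m where U: "orthogonal_matrix U"
    "\<And>x y z w. (\<Sum>a\<in>UNIV. \<Sum>b\<in>UNIV. sd_block W (-1) (-1) a b * (sd_unit (-1) a x \<bullet> y) * (sd_unit (-1) b z \<bullet> w))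
      = (\<Sum>k\<in>UNIV. m k * (rotated_unit (-1) U k x \<bullet> y) * (rotated_unit (-1) U k z \<bullet> w))"
    "(\<Sum>k\<in>UNIV. m k) = (\<Sum>a\<in>UNIV. sd_block W (-1) (-1) a a)"
    "(\<forall>a b. sd_block W (-1) (-1) a b = 0) \<longleftrightarrow> (\<forall>k. m k = 0)"
    by (rule sd_block_diagonalization[OF W, of "-1"]) (rule that)
  show ?thesis
  proof (rule that)
    show "quaternionic (rotated_unit 1 V)" "quaternionic (rotated_unit (-1) U)"
      by (simp_all add: quaternionic_rotated_unit V U)
    show "rotated_unit 1 V i (rotated_unit (-1) U j x) = rotated_unit (-1) U j (rotated_unit 1 V i x)" for i j x
      by (simp add: rotated_unit_commute)
    \<comment> \<open>The factor 1/4 of \<open>curvature_sd_expand\<close> is absorbed into the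
      coefficients.\<close>
    show "(\<Sum>k\<in>UNIV. l k / 4) = 0" "(\<Sum>k\<in>UNIV. m k / 4) = 0"
      using V(3) U(3) curvature_frame_relations[OF W flat]
      by (simp_all add: sum_divide_distrib[symmetric])
    show "W x y z w = (\<Sum>k\<in>UNIV. l k / 4 * (rotated_unit 1 V k x \<bullet> y) * (rotated_unit 1 V k z \<bullet> w))
      + (\<Sum>k\<in>UNIV. m k / 4 * (rotated_unit (-1) U k x \<bullet> y) * (rotated_unit (-1) U k z \<bullet> w))"
      for x y z w
      unfolding curvature_sd_expand[OF W flat, of x y z w] V(2) U(2)
      by (simp add: sum_divide_distrib)
    show "(\<forall>a z w. sd_coeff 1 (\<lambda>x y. W x y z w) a = 0) \<longleftrightarrow> (\<forall>k. l k / 4 = 0)"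
      "(\<forall>a z w. sd_coeff (-1) (\<lambda>x y. W x y z w) a = 0) \<longleftrightarrow> (\<forall>k. m k / 4 = 0)"
      using V(4) U(4) sd_coeff_curvature_zero_iff[OF W flat] by simp_all
  qed
qed

end

section \<open>Vanishing on the Hodge eigenspaces\<close>

lemma linear_Basis_expand:
  fixes f :: "'a::euclidean_space \<Rightarrow> real"
  assumes "linear f"
  shows "f x = (\<Sum>b\<in>Basis. (x \<bullet> b) * f b)"
proof -
  have "f x = f (\<Sum>b\<in>Basis. (x \<bullet> b) *\<^sub>R b)" by (simp only: euclidean_representation)
  also have "\<dots> = (\<Sum>b\<in>Basis. f ((x \<bullet> b) *\<^sub>R b))" by (rule linear_sum[OF assms])
  finally show ?thesis by (simp only: linear_scale[OF assms] real_scaleR_def)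
qed

lemma bilinear_Basis_expand:
  fixes g :: "'a::euclidean_space \<Rightarrow> 'a \<Rightarrow> real"
  assumes "bilinear g"
  shows "g x y = (\<Sum>i\<in>Basis. \<Sum>j\<in>Basis. (x \<bullet> i) * (y \<bullet> j) * g i j)"
proof -
  have 1: "linear (\<lambda>x. g x y)" and 2: "linear (\<lambda>y. g x y)" for x y
    using assms unfolding bilinear_def by auto
  have "g x y = (\<Sum>i\<in>Basis. (x \<bullet> i) * g i y)" by (rule linear_Basis_expand[OF 1])
  also have "\<dots> = (\<Sum>i\<in>Basis. (x \<bullet> i) * (\<Sum>j\<in>Basis. (y \<bullet> j) * g i j))"
    by (intro sum.cong refl arg_cong[of _ _ "times _"] linear_Basis_expand[OF 2])
  finally show ?thesis by (simp add: sum_distrib_left mult.assoc)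
qed

context frame4
begin

text \<open>The action contracts \<open>\<omega>\<close> with the first index pair of
  \<open>W\<close>. On complementary index pairs, ab + cd is half of (a + c)(b + d) + (a - c)(b -
  d), which splits the contraction along the two eigenspaces.\<close>

lemma two_form_action_eq:
  assumes W: "algebraic_curvature_tensor W" and \<omega>: "\<omega> \<in> two_forms"
  shows "two_form_action W \<omega> x y =
    (\<Sum>a\<in>UNIV. sd_coeff 1 \<omega> a * sd_coeff 1 (\<lambda>u v. W u v x y) a
      + sd_coeff (-1) \<omega> a * sd_coeff (-1) (\<lambda>u v. W u v x y) a) / 2"
proof -
  \<comment> \<open>By antisymmetry the wedge sum yields \<open>W p q x y\<close> twice, which the
    factor 1/2 undoes.\<close>
  have inner: "(1/2) * (\<Sum>i\<in>Basis. \<Sum>j\<in>Basis. W p q i j * wedge (inner i) (inner j) x y) = W p q x y"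
    for p q
  proof -
    have "bilinear (\<lambda>x y. W p q x y)"
      by (intro bilinearI curvature_tensorD[OF W])
    note exp = bilinear_Basis_expand[OF this]
    have "(\<Sum>i\<in>Basis. \<Sum>j\<in>Basis. W p q i j * wedge (inner i) (inner j) x y) = W p q x y - W p q y x"
      unfolding exp[of x y] exp[of y x]
      by (simp add: wedge_def sum_subtractf[symmetric] inner_commute algebra_simps)
    moreover have "W p q y x = - W p q x y"
      by (rule two_formD(3)[OF curvature_two_forms(2)[OF W]])
    ultimately show ?thesis by simp
  qed
  note D = two_formD[OF \<omega>] and E = two_formD[OF curvature_two_forms(1)[OF W]]
  have "(\<Sum>p\<in>Basis. \<Sum>q\<in>Basis. \<omega> p q * W p q x y)
      = (\<Sum>p\<in>Basis. \<Sum>j\<in>UNIV. \<omega> p (e j) * W p (e j) x y)"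
    by (intro sum.cong refl trace_frame bilinearI linearI)
      (simp_all add: linear_add[OF D(2)] linear_scale[OF D(2)] linear_add[OF E(2)]
        linear_scale[OF E(2)] algebra_simps)
  also have "\<dots> = (\<Sum>i\<in>UNIV. \<Sum>j\<in>UNIV. \<omega> (e i) (e j) * W (e i) (e j) x y)"
    by (intro trace_frame bilinearI linearI)
      (simp_all add: linear_add[OF D(1)] linear_scale[OF D(1)] linear_add[OF E(1)]
        linear_scale[OF E(1)] sum.distrib sum_distrib_left algebra_simps)
  finally have "two_form_action W \<omega> x y
      = (\<Sum>i\<in>UNIV. \<Sum>j\<in>UNIV. \<omega> (e i) (e j) * W (e i) (e j) x y) / 2"
    unfolding two_form_action_def inner by simp
  then show ?thesis
    unfolding sum_4 sum_3
    by (simp add: sd_coeff_def D(4) D(3)[of "e 2" "e 1"] D(3)[of "e 3" "e 1"] D(3)[of "e 4" "e 1"]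
        D(3)[of "e 3" "e 2"] D(3)[of "e 2" "e 4"] D(3)[of "e 4" "e 3"]
        E(3)[of "e 2" "e 1"] E(3)[of "e 3" "e 1"] E(3)[of "e 4" "e 1"]
        E(3)[of "e 3" "e 2"] E(3)[of "e 2" "e 4"] E(3)[of "e 4" "e 3"] algebra_simps)
qed

text \<open>In one direction the action is tested on the forms of \<open>sd_unit s a\<close>, each
  of which isolates one coefficient; in the other, an eigenform has only coefficients of sign
  \<open>s\<close>.\<close>

lemma vanishes_on_hodge_eigenspace_iff:
  assumes W: "algebraic_curvature_tensor W" and e: "oriented_frame \<O> = e"
    and s: "s = 1 \<or> s = -1"
  shows "(\<forall>\<omega>\<in>two_forms. (\<forall>x y. hodge_star \<O> \<omega> x y = s * \<omega> x y) \<longrightarrow>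
      (\<forall>x y. two_form_action W \<omega> x y = 0))
    \<longleftrightarrow> (\<forall>a z w. sd_coeff s (\<lambda>x y. W x y z w) a = 0)"
proof (intro iffI allI ballI impI)
  have ss: "s * s = 1" using s by auto
  {
    fix a z w
    assume *: "\<forall>\<omega>\<in>two_forms. (\<forall>x y. hodge_star \<O> \<omega> x y = s * \<omega> x y) \<longrightarrow>
      (\<forall>x y. two_form_action W \<omega> x y = 0)"
    have "two_form_action W (\<lambda>x y. sd_unit s a x \<bullet> y) z w = 0"
      using *[rule_format, OF sd_unit_two_form hodge_star_unit[OF ss e]] .
    then show "sd_coeff s (\<lambda>x y. W x y z w) a = 0"
      unfolding two_form_action_eq[OF W sd_unit_two_form] using s exhaust_3[of a]
      by (auto simp: sd_coeff_unit sum_3)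
  next
    fix \<omega> x y
    assume "\<forall>a z w. sd_coeff s (\<lambda>x y. W x y z w) a = 0" and \<omega>: "\<omega> \<in> two_forms"
      and "\<forall>x y. hodge_star \<O> \<omega> x y = s * \<omega> x y"
    moreover from this have "sd_coeff (-s) \<omega> a = 0" for a
      by (intro hodge_eigen_coeff[OF \<omega> e ss]) simp
    ultimately show "two_form_action W \<omega> x y = 0"
      unfolding two_form_action_eq[OF W \<omega>] using s by auto
  }
qed

lemma self_dual_iff:
  assumes "algebraic_curvature_tensor W" "oriented_frame \<O> = e"
  shows "self_dual \<O> W \<longleftrightarrow> (\<forall>a z w. sd_coeff (-1) (\<lambda>x y. W x y z w) a = 0)"
    and "anti_self_dual \<O> W \<longleftrightarrow> (\<forall>a z w. sd_coeff 1 (\<lambda>x y. W x y z w) a = 0)"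
  using vanishes_on_hodge_eigenspace_iff[OF assms, of "-1"]
    vanishes_on_hodge_eigenspace_iff[OF assms, of 1]
  by (auto simp: self_dual_def anti_self_dual_def Lambda_minus_def Lambda_plus_def fun_eq_iff)

lemma eigenvalues_diagonal:
  assumes "\<And>y. T y = (\<Sum>i\<in>UNIV. (\<mu> i * (y \<bullet> e i)) *\<^sub>R e i)"
  shows "eigenvalues T = range \<mu>"
proof -
  have coord: "T y \<bullet> e j = \<mu> j * (y \<bullet> e j)" for y j
    unfolding assms by (simp add: inner_sum_left inner_e if_distrib cong: if_cong)
  show ?thesis
  proof (intro set_eqI iffI)
    fix t assume "t \<in> eigenvalues T"
    then obtain v where v: "v \<noteq> 0" "T v = t *\<^sub>R v" by (auto simp: eigenvalues_def)
    obtain j where j: "v \<bullet> e j \<noteq> 0" using v(1) eqI[of v 0] by auto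
    have "\<mu> j * (v \<bullet> e j) = t * (v \<bullet> e j)" using coord[of v j] by (simp only: v(2) inner_scaleR_left)
    with j have "t = \<mu> j" by simp
    then show "t \<in> range \<mu>" by blast
  next
    fix t assume "t \<in> range \<mu>"
    then obtain j where j: "t = \<mu> j" by auto
    have "T (e j) = t *\<^sub>R e j"
      by (rule eqI) (auto simp: coord j inner_e)
    moreover have "e j \<noteq> 0" using inner_e[of j j] by auto
    ultimately show "t \<in> eigenvalues T" by (auto simp: eigenvalues_def)
  qed
qed

end

section \<open>Eigenvalues of the Jacobi operators\<close>

definition quaternionic_frame :: "(3 \<Rightarrow> 'a \<Rightarrow> 'a) \<Rightarrow> 'a \<Rightarrow> 4 \<Rightarrow> 'a" where
  "quaternionic_frame \<Phi> x i = (if i = 1 then \<Phi> 1 x else if i = 2 then \<Phi> 2 x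
     else if i = 3 then \<Phi> 3 x else x)"

lemma quaternionicD:
  assumes "quaternionic \<Phi>"
  shows "linear (\<Phi> i)" "\<Phi> i x \<bullet> y = - (x \<bullet> \<Phi> i y)" "\<Phi> i (\<Phi> i x) = - x"
    "i \<noteq> j \<Longrightarrow> \<Phi> i (\<Phi> j x) = - \<Phi> j (\<Phi> i x)"
    "\<Phi> i x \<bullet> x = 0" "x \<bullet> \<Phi> i x = 0"
    "\<Phi> i x \<bullet> \<Phi> j x = (if i = j then x \<bullet> x else 0)"
proof -
  have anti: "\<Phi> i (\<Phi> j x) + \<Phi> j (\<Phi> i x) = (- 2 * (if i = j then 1 else 0)) *\<^sub>R x" for i j x
    using assms by (simp add: quaternionic_def)
  show "linear (\<Phi> i)" and skew: "\<Phi> i x \<bullet> y = - (x \<bullet> \<Phi> i y)" for i x y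
    using assms unfolding quaternionic_def skew_adjoint_def by blast+
  have "2 *\<^sub>R (\<Phi> i (\<Phi> i x)) = 2 *\<^sub>R (- x)" for i x
    using anti[of i i x] by (simp add: scaleR_2)
  then show sq: "\<Phi> i (\<Phi> i x) = - x" for i x
    by (metis scaleR_cancel_left zero_neq_numeral)
  show ac: "\<Phi> i (\<Phi> j x) = - \<Phi> j (\<Phi> i x)" if "i \<noteq> j" for i j
    using anti[of i j x] that by (simp add: eq_neg_iff_add_eq_0)
  show "\<Phi> i x \<bullet> x = 0" "x \<bullet> \<Phi> i x = 0"
    using skew[of i x x] by (simp_all add: inner_commute)
  show "\<Phi> i x \<bullet> \<Phi> j x = (if i = j then x \<bullet> x else 0)"
  proof (cases "i = j")
    case True
    then show ?thesis using skew[of i x "\<Phi> i x"] by (simp add: sq)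
  next
    case False
    have "\<Phi> i x \<bullet> \<Phi> j x = - (x \<bullet> \<Phi> i (\<Phi> j x))" by (rule skew)
    also have "\<dots> = x \<bullet> \<Phi> j (\<Phi> i x)" by (simp add: ac[OF False])
    also have "\<dots> = - (\<Phi> j x \<bullet> \<Phi> i x)" using skew[of j x "\<Phi> i x"] by simp
    finally show ?thesis using False by (simp add: inner_commute)
  qed
qed

lemma quaternionic_frame_orthonormal:
  assumes \<Phi>: "quaternionic \<Phi>" and x: "x \<bullet> x = 1"
  shows "orthonormal_frame (quaternionic_frame \<Phi> x)"
  unfolding orthonormal_frame_def forall_4
  by (simp add: quaternionic_frame_def quaternionicD(5,6,7)[OF \<Phi>] x)

lemma eigenvalues_quaternionic_frame:
  fixes \<Phi> :: "3 \<Rightarrow> 'a::euclidean_space \<Rightarrow> 'a"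
  assumes dim: "DIM('a) = 4" and \<Phi>: "quaternionic \<Phi>" and x: "x \<bullet> x = 1"
    and T: "\<And>y. T y = (\<Sum>k\<in>UNIV. (c k * (y \<bullet> \<Phi> k x)) *\<^sub>R \<Phi> k x)"
  shows "eigenvalues T = {0, c 1, c 2, c 3}"
proof -
  interpret f: frame4 "quaternionic_frame \<Phi> x"
    by standard (rule dim, rule quaternionic_frame_orthonormal[OF \<Phi> x])
  \<comment> \<open>The fourth frame vector is \<open>x\<close> itself; it is orthogonal to all
    \<open>\<Phi> k x\<close> and gives the eigenvalue 0.\<close>
  let ?\<mu> = "\<lambda>i::4. if i = 1 then c 1 else if i = 2 then c 2 else if i = 3 then c 3 else 0"
  have "T y = (\<Sum>i\<in>UNIV. (?\<mu> i * (y \<bullet> quaternionic_frame \<Phi> x i)) *\<^sub>R quaternionic_frame \<Phi> x i)" for y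
    unfolding T sum_3 sum_4 by (simp add: quaternionic_frame_def)
  then have "eigenvalues T = range ?\<mu>" by (rule f.eigenvalues_diagonal)
  also have "range ?\<mu> = {0, c 1, c 2, c 3}" unfolding UNIV_4 by auto
  finally show ?thesis .
qed

text \<open>Either \<open>u + P u\<close> is a nonzero fixed vector or \<open>P u = - u\<close>. The
  first conclusion records this construction: an eigenspace of an operator commuting with
  \<open>P\<close> that contains \<open>u\<close> also contains \<open>x\<close>, so the lemma can
  be iterated.\<close>

lemma involution_eigenvector:
  fixes P :: "'a::real_vector \<Rightarrow> 'a"
  assumes "linear P" "\<And>x. P (P x) = x" "u \<noteq> 0"
  obtains x \<epsilon> where "x = u \<or> x = u + P u" "x \<noteq> 0" "\<epsilon> = 1 \<or> \<epsilon> = -1" "P x = \<epsilon> *\<^sub>R x"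
proof (cases "u + P u = 0")
  case True
  then have "P u = (-1) *\<^sub>R u" by (simp add: eq_neg_iff_add_eq_0 add.commute)
  then show ?thesis using assms(3) that[of u "-1"] by simp
next
  case False
  have "P (u + P u) = 1 *\<^sub>R (u + P u)"
    by (simp add: linear_add[OF assms(1)] assms(2) add.commute)
  with False show ?thesis using that[of "u + P u" 1] by simp
qed

text \<open>The commuting involutions \<open>\<Phi> k \<circ> \<Psi> k\<close> have a common eigenvector.\<close>

lemma quaternionic_alignment:
  fixes \<Phi> \<Psi> :: "3 \<Rightarrow> 'a::euclidean_space \<Rightarrow> 'a"
  assumes dim: "DIM('a) = 4" and \<Phi>: "quaternionic \<Phi>" and \<Psi>: "quaternionic \<Psi>"
    and comm: "\<And>i j x. \<Phi> i (\<Psi> j x) = \<Psi> j (\<Phi> i x)"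
  obtains x \<epsilon> where "x \<bullet> x = 1" "\<And>k. \<epsilon> k * \<epsilon> k = (1::real)" "\<And>k. \<Psi> k x = \<epsilon> k *\<^sub>R \<Phi> k x"
proof -
  note F = quaternionicD[OF \<Phi>] and G = quaternionicD[OF \<Psi>]
  define P where "P k x = \<Phi> k (\<Psi> k x)" for k x
  have lin: "linear (P k)" for k
    unfolding P_def using linear_compose[OF G(1) F(1)] by (simp add: o_def)
  have inv: "P k (P k x) = x" for k x
    by (simp add: P_def comm F(3) G(3) linear_neg[OF F(1)] linear_neg[OF G(1)])
  \<comment> \<open>Exchanging the \<open>\<Phi>\<close> and exchanging the \<open>\<Psi>\<close>
    each gives a sign, and the two signs cancel.\<close>
  have Pcomm: "P 2 (P 1 x) = P 1 (P 2 x)" for x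
    by (simp add: P_def comm[symmetric] F(4)[of 2 1] G(4)[of 2 1] linear_neg[OF F(1)] linear_neg[OF G(1)])
  obtain u :: 'a where "u \<noteq> 0" using nonempty_Basis nonzero_Basis by blast
  with lin inv obtain x1 \<epsilon>1 where x1: "x1 \<noteq> 0" "\<epsilon>1 = 1 \<or> \<epsilon>1 = -1" "P 1 x1 = \<epsilon>1 *\<^sub>R x1"
    by (metis involution_eigenvector)
  from lin inv x1(1) obtain x2 \<epsilon>2 where x2: "x2 = x1 \<or> x2 = x1 + P 2 x1" "x2 \<noteq> 0"
      "\<epsilon>2 = 1 \<or> \<epsilon>2 = -1" "P 2 x2 = \<epsilon>2 *\<^sub>R x2"
    by (metis involution_eigenvector)
  have x21: "P 1 x2 = \<epsilon>1 *\<^sub>R x2"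
    using x2(1) x1(3) by (auto simp: linear_add[OF lin] Pcomm[symmetric] linear_scale[OF lin] scaleR_add_right)
  define x where "x = (1 / norm x2) *\<^sub>R x2"
  have x: "x \<bullet> x = 1" using x2(2) by (simp add: x_def power2_norm_eq_inner[symmetric] power2_eq_square)
  have aux: "\<Psi> k x = (- \<epsilon>) *\<^sub>R \<Phi> k x" if "P k x2 = \<epsilon> *\<^sub>R x2" for k \<epsilon>
  proof -
    have "P k x = \<epsilon> *\<^sub>R x" using that by (simp add: x_def linear_scale[OF lin])
    then have "\<Phi> k (P k x) = \<epsilon> *\<^sub>R \<Phi> k x" by (simp add: linear_scale[OF F(1)])
    then have "- \<Psi> k x = \<epsilon> *\<^sub>R \<Phi> k x" by (simp add: P_def F(3))
    then show ?thesis by (metis minus_minus scaleR_minus_left)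
  qed
  have e1: "\<Psi> 1 x = (- \<epsilon>1) *\<^sub>R \<Phi> 1 x" and e2: "\<Psi> 2 x = (- \<epsilon>2) *\<^sub>R \<Phi> 2 x"
    using aux x21 x2(4) by blast+
  interpret f: frame4 "quaternionic_frame \<Phi> x"
    by standard (rule dim, rule quaternionic_frame_orthonormal[OF \<Phi> x])
  define t where "t = \<Psi> 3 x \<bullet> \<Phi> 3 x"
  \<comment> \<open>Two involutions suffice: \<open>\<Psi> 3 x\<close> is orthogonal to
    \<open>x\<close> and to \<open>\<Psi> 1 x\<close>, \<open>\<Psi> 2 x\<close>, hence to
    \<open>\<Phi> 1 x\<close> and \<open>\<Phi> 2 x\<close>, and only the direction of
    \<open>\<Phi> 3 x\<close> is left.\<close>
  have "\<Psi> 3 x \<bullet> \<Phi> 1 x = 0"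
    using G(7)[of 3 x 1] x1(2) by (auto simp: e1)
  moreover have "\<Psi> 3 x \<bullet> \<Phi> 2 x = 0"
    using G(7)[of 3 x 2] x2(3) by (auto simp: e2)
  ultimately have e3: "\<Psi> 3 x = t *\<^sub>R \<Phi> 3 x"
    using f.expand[of "\<Psi> 3 x"] unfolding sum_4
    by (simp add: quaternionic_frame_def G(5) t_def)
  have "t * t = 1"
    using G(7)[of 3 x 3] by (simp add: e3 F(7) x)
  define \<epsilon> where "\<epsilon> k = (if k = 1 then - \<epsilon>1 else if k = 2 then - \<epsilon>2 else t)" for k :: 3
  show ?thesis
  proof (rule that[OF x])
    show "\<epsilon> k * \<epsilon> k = 1" for k using x1(2) x2(3) \<open>t * t = 1\<close> by (auto simp: \<epsilon>_def)
    show "\<Psi> k x = \<epsilon> k *\<^sub>R \<Phi> k x" for k using exhaust_3[of k] by (auto simp: \<epsilon>_def e1 e2 e3)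
  qed
qed

section \<open>Constant eigenvalues force one family of coefficients to vanish\<close>

lemma sum_squares_from_value_set:
  fixes p q r :: real
  assumes "p + q + r = 0" "p' + q' + r' = 0" and "{0, p, q, r} = {0, p', q', r'}"
  shows "p\<^sup>2 + q\<^sup>2 + r\<^sup>2 = p'\<^sup>2 + q'\<^sup>2 + r'\<^sup>2"
proof -
  \<comment> \<open>The set hides multiplicities. As the values sum to zero, 0 lies between the
    extremes; these are taken at two positions, and the third value is minus their sum.\<close>
  have *: "p\<^sup>2 + q\<^sup>2 + r\<^sup>2 = (Max {0, p, q, r})\<^sup>2 + (Min {0, p, q, r})\<^sup>2
      + (Max {0, p, q, r} + Min {0, p, q, r})\<^sup>2" if "p + q + r = 0" for p q r :: real
  proof -
    have Max: "Max {0, p, q, r} = max p (max q r)" and Min: "Min {0, p, q, r} = min p (min q r)"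
      using that by (auto simp: max_def min_def)
    define M m where "M = max p (max q r)" and "m = min p (min q r)"
    have "M = p \<and> m = q \<or> M = q \<and> m = p \<or> M = p \<and> m = r \<or> M = r \<and> m = p
        \<or> M = q \<and> m = r \<or> M = r \<and> m = q"
      using that by (auto simp: M_def m_def max_def min_def)
    then have "p\<^sup>2 + q\<^sup>2 + r\<^sup>2 = M\<^sup>2 + m\<^sup>2 + (M + m)\<^sup>2"
      using that by (elim disjE conjE) algebra+
    then show ?thesis unfolding Max Min M_def m_def .
  qed
  show ?thesis unfolding *[OF assms(1)] *[OF assms(2)] assms(3) ..
qed

lemma permuted_products_constant:
  fixes \<alpha> \<beta> :: "3 \<Rightarrow> real"
  assumes sum: "(\<Sum>k\<in>UNIV. \<alpha> k) = 0" "(\<Sum>k\<in>UNIV. \<beta> k) = 0"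
    and const: "\<And>\<sigma>. inj \<sigma> \<Longrightarrow> (\<Sum>k\<in>UNIV. \<alpha> k * \<beta> (\<sigma> k)) = C"
  shows "(\<forall>k. \<alpha> k = 0) \<or> (\<forall>k. \<beta> k = 0)"
proof -
  have ex_3: "(\<exists>p::3. P p) \<longleftrightarrow> P 1 \<or> P 2 \<or> P 3" for P
    using forall_3[of "\<lambda>p. \<not> P p"] by blast
  have "\<forall>i j::3. i \<noteq> j \<longrightarrow> (\<exists>p. p \<noteq> i \<and> p \<noteq> j \<and> (\<forall>m. m = i \<or> m = j \<or> m = p))"
    unfolding forall_3 ex_3 by simp
  then have third: "\<exists>p. p \<noteq> i \<and> p \<noteq> j \<and> UNIV = {i, j, p}" if "i \<noteq> j" for i j :: 3
    using that unfolding set_eq_iff by simp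
  have prod: "(\<alpha> i - \<alpha> j) * (\<beta> k - \<beta> l) = 0" if ij: "i \<noteq> j" and kl: "k \<noteq> l" for i j k l
  proof -
    obtain p where p: "p \<noteq> i" "p \<noteq> j" "UNIV = {i, j, p}" using third[OF ij] by blast
    obtain q where q: "q \<noteq> k" "q \<noteq> l" using third[OF kl] by blast
    \<comment> \<open>\<open>?\<sigma>\<close> and \<open>?\<tau>\<close> differ by exchanging
      \<open>k\<close> and \<open>l\<close>; the term at \<open>p\<close> is common to both sums and
      cancels, and the rest factors.\<close>
    let ?\<sigma> = "\<lambda>m. if m = i then k else if m = j then l else q"
    let ?\<tau> = "\<lambda>m. if m = i then l else if m = j then k else q"
    have all: "m = i \<or> m = j \<or> m = p" for m using p(3) by blast
    have sum3: "sum f UNIV = f i + f j + f p" for f :: "3 \<Rightarrow> real"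
      unfolding p(3) using p(1,2) ij by (simp add: not_sym)
    have "inj ?\<sigma>"
    proof (rule injI)
      show "a = b" if "?\<sigma> a = ?\<sigma> b" for a b
        using that all[of a] all[of b] q kl by (auto split: if_splits)
    qed
    moreover have "inj ?\<tau>"
    proof (rule injI)
      show "a = b" if "?\<tau> a = ?\<tau> b" for a b
        using that all[of a] all[of b] q kl by (auto split: if_splits)
    qed
    ultimately have "(\<Sum>m\<in>UNIV. \<alpha> m * \<beta> (?\<sigma> m)) = (\<Sum>m\<in>UNIV. \<alpha> m * \<beta> (?\<tau> m))"
      using const[of ?\<sigma>] const[of ?\<tau>] by simp
    then have "\<alpha> i * \<beta> k + \<alpha> j * \<beta> l = \<alpha> i * \<beta> l + \<alpha> j * \<beta> k"
      unfolding sum3 using p(1,2) ij by simp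
    then show ?thesis by (simp add: algebra_simps)
  qed
  show ?thesis
  proof (cases "\<exists>i j. \<alpha> i \<noteq> \<alpha> j")
    case True
    then obtain i j where "\<alpha> i \<noteq> \<alpha> j" by blast
    then have "\<beta> k = \<beta> l" for k l using prod[of i j k l] by (cases "k = l") auto
    then have eq: "\<beta> k = \<beta> 1" for k by blast
    have "3 * \<beta> 1 = 0" using sum(2) eq[of 2] eq[of 3] by (simp add: sum_3)
    then show ?thesis using eq by simp
  next
    case False
    then have eq: "\<alpha> k = \<alpha> 1" for k by metis
    have "3 * \<alpha> 1 = 0" using sum(1) eq[of 2] eq[of 3] by (simp add: sum_3)
    then show ?thesis using eq by simp
  qed
qed

text \<open>\<open>quaternionic\<close> asks for anticommutation but does not fix the sign of the
  triple product, so odd permutations are admissible as well.\<close>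

lemma quaternionic_permute:
  assumes "quaternionic \<Psi>" "inj \<sigma>"
  shows "quaternionic (\<lambda>k. \<Psi> (\<sigma> k))"
  using assms by (simp add: quaternionic_def inj_eq)

lemma eigenvalues_constant_imp_zero:
  fixes \<Phi> \<Psi> :: "3 \<Rightarrow> 'a::euclidean_space \<Rightarrow> 'a"
  assumes dim: "DIM('a) = 4" and \<Phi>: "quaternionic \<Phi>" and \<Psi>: "quaternionic \<Psi>"
    and comm: "\<And>i j x. \<Phi> i (\<Psi> j x) = \<Psi> j (\<Phi> i x)"
    and \<alpha>: "(\<Sum>k\<in>UNIV. \<alpha> k) = 0" and \<beta>: "(\<Sum>k\<in>UNIV. \<beta> k) = 0"
    and J: "\<And>x y. J x y = (\<Sum>k\<in>UNIV. (\<alpha> k * (y \<bullet> \<Phi> k x)) *\<^sub>R \<Phi> k x)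
      + (\<Sum>k\<in>UNIV. (\<beta> k * (y \<bullet> \<Psi> k x)) *\<^sub>R \<Psi> k x)"
    and const: "\<And>x x'. x \<bullet> x = 1 \<Longrightarrow> x' \<bullet> x' = 1 \<Longrightarrow> eigenvalues (J x) = eigenvalues (J x')"
  shows "(\<forall>k. \<alpha> k = 0) \<or> (\<forall>k. \<beta> k = 0)"
proof -
  have perm: "\<exists>x. x \<bullet> x = 1 \<and> eigenvalues (J x)
      = {0, \<alpha> 1 + \<beta> (\<sigma> 1), \<alpha> 2 + \<beta> (\<sigma> 2), \<alpha> 3 + \<beta> (\<sigma> 3)}" if \<sigma>: "inj \<sigma>" for \<sigma> :: "3 \<Rightarrow> 3"
  proof -
    obtain x and \<epsilon> :: "3 \<Rightarrow> real" where x: "x \<bullet> x = 1" and \<epsilon>: "\<And>k. \<epsilon> k * \<epsilon> k = 1"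
      and e: "\<And>k. \<Psi> (\<sigma> k) x = \<epsilon> k *\<^sub>R \<Phi> k x"
      by (rule quaternionic_alignment[OF dim \<Phi> quaternionic_permute[OF \<Psi> \<sigma>] comm]) (rule that)
    have "bij_betw \<sigma> UNIV UNIV" using \<sigma> by (simp add: bij_betw_def finite_UNIV_inj_surj)
    have "J x y = (\<Sum>k\<in>UNIV. ((\<alpha> k + \<beta> (\<sigma> k)) * (y \<bullet> \<Phi> k x)) *\<^sub>R \<Phi> k x)" for y
    proof -
      have "(\<Sum>k\<in>UNIV. (\<beta> k * (y \<bullet> \<Psi> k x)) *\<^sub>R \<Psi> k x)
          = (\<Sum>k\<in>UNIV. (\<beta> (\<sigma> k) * (y \<bullet> \<Psi> (\<sigma> k) x)) *\<^sub>R \<Psi> (\<sigma> k) x)"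
        by (rule sum.reindex_bij_betw[OF \<open>bij_betw \<sigma> UNIV UNIV\<close>, symmetric])
      also have "\<dots> = (\<Sum>k\<in>UNIV. (\<beta> (\<sigma> k) * (y \<bullet> \<Phi> k x)) *\<^sub>R \<Phi> k x)"
      proof (intro sum.cong refl)
        fix k
        \<comment> \<open>The alignment sign enters twice and squares to 1.\<close>
        have "\<beta> (\<sigma> k) * (\<epsilon> k * (y \<bullet> \<Phi> k x)) * \<epsilon> k = \<beta> (\<sigma> k) * (y \<bullet> \<Phi> k x)"
          using \<epsilon>[of k] by algebra
        then show "(\<beta> (\<sigma> k) * (y \<bullet> \<Psi> (\<sigma> k) x)) *\<^sub>R \<Psi> (\<sigma> k) x = (\<beta> (\<sigma> k) * (y \<bullet> \<Phi> k x)) *\<^sub>R \<Phi> k x"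
          by (simp add: e)
      qed
      finally show ?thesis by (simp add: J sum.distrib[symmetric] distrib_right scaleR_add_left)
    qed
    from eigenvalues_quaternionic_frame[OF dim \<Phi> x this] x show ?thesis by blast
  qed
  have perm_sum: "(\<Sum>k\<in>UNIV. \<beta> (\<sigma> k)) = 0" if "inj \<sigma>" for \<sigma> :: "3 \<Rightarrow> 3"
    using sum.reindex_bij_betw[of \<sigma> UNIV UNIV \<beta>] that \<beta> by (simp add: bij_betw_def finite_UNIV_inj_surj)
  have sq: "(\<Sum>k\<in>UNIV. (\<alpha> k + \<beta> (\<sigma> k))\<^sup>2) = (\<Sum>k\<in>UNIV. (\<alpha> k + \<beta> k)\<^sup>2)" if \<sigma>: "inj \<sigma>" for \<sigma> :: "3 \<Rightarrow> 3"
  proof -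
    have "{0, \<alpha> 1 + \<beta> (\<sigma> 1), \<alpha> 2 + \<beta> (\<sigma> 2), \<alpha> 3 + \<beta> (\<sigma> 3)}
        = {0, \<alpha> 1 + \<beta> 1, \<alpha> 2 + \<beta> 2, \<alpha> 3 + \<beta> 3}"
      using perm[OF \<sigma>] perm[OF inj_on_id] const by (metis id_apply)
    moreover have "(\<alpha> 1 + \<beta> (\<sigma> 1)) + (\<alpha> 2 + \<beta> (\<sigma> 2)) + (\<alpha> 3 + \<beta> (\<sigma> 3)) = 0"
      using \<alpha> perm_sum[OF \<sigma>] by (simp add: sum_3)
    moreover have "(\<alpha> 1 + \<beta> 1) + (\<alpha> 2 + \<beta> 2) + (\<alpha> 3 + \<beta> 3) = 0"
      using \<alpha> \<beta> by (simp add: sum_3)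
    ultimately show ?thesis
      unfolding sum_3 by (intro sum_squares_from_value_set)
  qed
  \<comment> \<open>Permuting \<open>\<beta>\<close> preserves its sum of squares, so the equality
    \<open>sq\<close> leaves equal cross terms.\<close>
  have "(\<Sum>k\<in>UNIV. \<alpha> k * \<beta> (\<sigma> k)) = (\<Sum>k\<in>UNIV. \<alpha> k * \<beta> k)" if \<sigma>: "inj \<sigma>" for \<sigma> :: "3 \<Rightarrow> 3"
  proof -
    have "bij_betw \<sigma> UNIV UNIV" using \<sigma> by (simp add: bij_betw_def finite_UNIV_inj_surj)
    then have "(\<Sum>k\<in>UNIV. (\<beta> (\<sigma> k))\<^sup>2) = (\<Sum>k\<in>UNIV. (\<beta> k)\<^sup>2)"
      by (rule sum.reindex_bij_betw)
    moreover have "(\<Sum>k\<in>UNIV. (\<alpha> k + f k)\<^sup>2) = (\<Sum>k\<in>UNIV. (\<alpha> k)\<^sup>2) + (\<Sum>k\<in>UNIV. (f k)\<^sup>2)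
        + 2 * (\<Sum>k\<in>UNIV. \<alpha> k * f k)" for f
      by (simp add: power2_sum sum.distrib sum_distrib_left mult.assoc)
    ultimately show ?thesis using sq[OF \<sigma>] by simp
  qed
  with \<alpha> \<beta> show ?thesis by (rule permuted_products_constant)
qed

section \<open>The operators \<open>R_Phi\<close> and the equivalence of the three
  conditions\<close>

text \<open>The sum of the \<open>c k *\<^sub>R R_Phi (\<Phi> k)\<close> equals \<open>W\<close> because of the Bianchi identity for \<open>W\<close> itself.\<close>

lemma R_Phi_sum:
  assumes W: "algebraic_curvature_tensor W" and \<Phi>: "quaternionic \<Phi>"
    and eq: "\<And>x y z w. W x y z w = (\<Sum>k\<in>UNIV. \<alpha> k * (\<Phi> k x \<bullet> y) * (\<Phi> k z \<bullet> w))"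
  shows "(\<Sum>k\<in>UNIV. (- \<alpha> k / 3) *\<^sub>R R_Phi (\<Phi> k) x y z) \<bullet> w = W x y z w"
proof -
  have sk: "\<Phi> k z \<bullet> x = - (\<Phi> k x \<bullet> z)" for k
    using quaternionicD(2)[OF \<Phi>, of k z x] by (simp only: inner_commute)
  \<comment> \<open>Paired with \<open>w\<close>, \<open>R_Phi (\<Phi> k) x y z\<close> is the
    cyclic sum of \<open>(\<Phi> k x \<bullet> y) * (\<Phi> k z \<bullet> w)\<close> over
    \<open>x\<close>, \<open>y\<close>, \<open>z\<close> minus three times that product; this is the
    origin of the factor -1/3.\<close>
  have "(\<Sum>k\<in>UNIV. (- \<alpha> k / 3) *\<^sub>R R_Phi (\<Phi> k) x y z) \<bullet> w
    = (\<Sum>k\<in>UNIV. \<alpha> k * (\<Phi> k x \<bullet> y) * (\<Phi> k z \<bullet> w)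
        - (\<alpha> k * (\<Phi> k x \<bullet> y) * (\<Phi> k z \<bullet> w) + \<alpha> k * (\<Phi> k y \<bullet> z) * (\<Phi> k x \<bullet> w)
          + \<alpha> k * (\<Phi> k z \<bullet> x) * (\<Phi> k y \<bullet> w)) / 3)"
    unfolding inner_sum_left
    by (intro sum.cong refl) (simp add: R_Phi_def inner_diff_left sk, simp add: field_simps)
  also have "\<dots> = W x y z w - (W x y z w + W y z x w + W z x y w) / 3"
    by (simp add: eq sum_subtractf sum.distrib sum_divide_distrib[symmetric])
  finally show ?thesis using curvature_tensorD(7)[OF W, of x y z w] by simp
qed

text \<open>The term with \<open>\<Phi> k x \<bullet> x\<close> vanishes by skewness and the other
  two are parallel, with weights 1 and 2.\<close>

lemma R_Phi_jacobi:
  assumes "quaternionic \<Phi>"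
  shows "R_Phi (\<Phi> k) y x x = (3 * (y \<bullet> \<Phi> k x)) *\<^sub>R \<Phi> k x"
proof -
  have "\<Phi> k y \<bullet> x = - (y \<bullet> \<Phi> k x)" by (rule quaternionicD(2)[OF assms])
  then show ?thesis
    by (simp add: R_Phi_def quaternionicD(5)[OF assms] scaleR_add_left[symmetric])
qed

text \<open>Reindexing replaces the natural numbers 1, 2, 3 by the type \<open>3\<close>, where sums
  and quantifiers range over the whole type.\<close>

lemma unitary_quaternion_structure_iff:
  fixes W :: "'a::euclidean_space \<Rightarrow> 'a \<Rightarrow> 'a \<Rightarrow> 'a"
  shows "(\<exists>(\<Phi> :: nat \<Rightarrow> 'a \<Rightarrow> 'a) (c :: nat \<Rightarrow> real).
      unitary_quaternion_structure \<Phi> \<and> c 1 + c 2 + c 3 = 0 \<and>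
      (\<forall>x y z. W x y z = c 1 *\<^sub>R R_Phi (\<Phi> 1) x y z + c 2 *\<^sub>R R_Phi (\<Phi> 2) x y z
         + c 3 *\<^sub>R R_Phi (\<Phi> 3) x y z))
    \<longleftrightarrow> (\<exists>(\<Phi> :: 3 \<Rightarrow> 'a \<Rightarrow> 'a) c. quaternionic \<Phi> \<and> (\<Sum>k\<in>UNIV. c k) = 0 \<and>
      (\<forall>x y z. W x y z = (\<Sum>k\<in>UNIV. c k *\<^sub>R R_Phi (\<Phi> k) x y z)))"
  (is "?L \<longleftrightarrow> ?R")
proof
  define ix where "ix k = (if k = 1 then 1 else if k = 2 then 2 else 3 :: nat)" for k :: 3
  assume ?L
  then obtain \<Phi> :: "nat \<Rightarrow> 'a \<Rightarrow> 'a" and c :: "nat \<Rightarrow> real"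
    where \<Phi>: "unitary_quaternion_structure \<Phi>" and c: "c 1 + c 2 + c 3 = 0"
    and W: "\<And>x y z. W x y z = c 1 *\<^sub>R R_Phi (\<Phi> 1) x y z + c 2 *\<^sub>R R_Phi (\<Phi> 2) x y z
         + c 3 *\<^sub>R R_Phi (\<Phi> 3) x y z" by blast
  have mem: "ix k \<in> {1, 2, 3}" and inj: "ix j = ix k \<longleftrightarrow> j = k" for j k
    using exhaust_3[of j] exhaust_3[of k] by (auto simp: ix_def)
  have "quaternionic (\<lambda>k. \<Phi> (ix k))"
    unfolding quaternionic_def
  proof (intro conjI allI)
    show "skew_adjoint (\<Phi> (ix i))" for i
      using \<Phi> mem[of i] unfolding unitary_quaternion_structure_def by blast
    show "\<Phi> (ix i) (\<Phi> (ix j) x) + \<Phi> (ix j) (\<Phi> (ix i) x) = (- 2 * (if i = j then 1 else 0)) *\<^sub>R x"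
      for i j x
      using \<Phi> mem[of i] mem[of j]
      unfolding unitary_quaternion_structure_def inj[of i j, symmetric] by blast
  qed
  moreover have "(\<Sum>k\<in>UNIV. c (ix k)) = 0" using c unfolding sum_3 by (simp add: ix_def)
  moreover have "W x y z = (\<Sum>k\<in>UNIV. c (ix k) *\<^sub>R R_Phi (\<Phi> (ix k)) x y z)" for x y z
    unfolding sum_3 W by (simp add: ix_def)
  ultimately show ?R by (intro exI[of _ "\<lambda>k. \<Phi> (ix k)"] exI[of _ "\<lambda>k. c (ix k)"]) blast
next
  \<comment> \<open>The default 3 extends the family to all natural numbers; injectivity is needed
    only on 1, 2, 3.\<close>
  define ix where "ix n = (if n = 1 then 1 else if n = 2 then 2 else 3 :: 3)" for n :: nat
  assume ?R
  then obtain \<Phi> :: "3 \<Rightarrow> 'a \<Rightarrow> 'a" and c where \<Phi>: "quaternionic \<Phi>" and c: "(\<Sum>k\<in>UNIV. c k) = 0"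
    and W: "\<And>x y z. W x y z = (\<Sum>k\<in>UNIV. c k *\<^sub>R R_Phi (\<Phi> k) x y z)" by blast
  have inj: "i = j \<longleftrightarrow> ix i = ix j" if "i \<in> {1, 2, 3}" "j \<in> {1, 2, 3}" for i j
    using that by (auto simp: ix_def)
  have "unitary_quaternion_structure (\<lambda>n. \<Phi> (ix n))"
    unfolding unitary_quaternion_structure_def
  proof (intro conjI ballI allI)
    show "skew_adjoint (\<Phi> (ix i))" for i
      using \<Phi> unfolding quaternionic_def by blast
    show "\<Phi> (ix i) (\<Phi> (ix j) x) + \<Phi> (ix j) (\<Phi> (ix i) x) = (- 2 * (if i = j then 1 else 0)) *\<^sub>R x"
      if "i \<in> {1, 2, 3}" "j \<in> {1, 2, 3}" for i j x
      using \<Phi> unfolding quaternionic_def inj[OF that] by blast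
  qed
  moreover have "c (ix 1) + c (ix 2) + c (ix 3) = 0" using c by (simp add: sum_3 ix_def)
  moreover have "\<forall>x y z. W x y z = c (ix 1) *\<^sub>R R_Phi (\<Phi> (ix 1)) x y z
      + c (ix 2) *\<^sub>R R_Phi (\<Phi> (ix 2)) x y z + c (ix 3) *\<^sub>R R_Phi (\<Phi> (ix 3)) x y z"
    unfolding W sum_3 by (simp add: ix_def)
  ultimately show ?L
    by (intro exI[of _ "\<lambda>n. \<Phi> (ix n)"] exI[of _ "\<lambda>n. c (ix n)"] conjI)
qed

theorem theorem2:
  fixes R :: "'a::euclidean_space \<Rightarrow> 'a \<Rightarrow> 'a \<Rightarrow> 'a \<Rightarrow> real"
    and \<O> :: "(4 \<Rightarrow> 'a) set"
  assumes "DIM('a) = 4"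
    and "\<O> \<in> orientations"
    and "algebraic_curvature_tensor R"
  shows "(conformally_osserman R \<longleftrightarrow>
            self_dual \<O> (weyl_tensor R) \<or> anti_self_dual \<O> (weyl_tensor R)) \<and>
         (self_dual \<O> (weyl_tensor R) \<or> anti_self_dual \<O> (weyl_tensor R) \<longleftrightarrow>
            (\<exists>(\<Phi> :: nat \<Rightarrow> 'a \<Rightarrow> 'a) (c :: nat \<Rightarrow> real).
               unitary_quaternion_structure \<Phi> \<and> c 1 + c 2 + c 3 = 0 \<and>
               (\<forall>x y z. weyl_op R x y z =
                  c 1 *\<^sub>R R_Phi (\<Phi> 1) x y z + c 2 *\<^sub>R R_Phi (\<Phi> 2) x y z
                  + c 3 *\<^sub>R R_Phi (\<Phi> 3) x y z)))"
proof -
  let ?W = "weyl_tensor R"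
  define e where "e = oriented_frame \<O>"
  interpret frame4 e
    by standard (simp_all add: assms(1) e_def oriented_frame_orthonormal[OF assms(1,2)])
  have W: "algebraic_curvature_tensor ?W" by (rule weyl_curvature_tensor[OF assms(3,1)])
  obtain \<Phi> \<Psi> \<alpha> \<beta> where \<Phi>: "quaternionic \<Phi>" and \<Psi>: "quaternionic \<Psi>"
    and comm: "\<And>i j x. \<Phi> i (\<Psi> j x) = \<Psi> j (\<Phi> i x)"
    and \<alpha>: "(\<Sum>k\<in>UNIV. \<alpha> k) = 0" and \<beta>: "(\<Sum>k\<in>UNIV. \<beta> k) = 0"
    and dec: "\<And>x y z w. ?W x y z w = (\<Sum>k\<in>UNIV. \<alpha> k * (\<Phi> k x \<bullet> y) * (\<Phi> k z \<bullet> w))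
      + (\<Sum>k\<in>UNIV. \<beta> k * (\<Psi> k x \<bullet> y) * (\<Psi> k z \<bullet> w))"
    and sd: "(\<forall>a z w. sd_coeff 1 (\<lambda>x y. ?W x y z w) a = 0) \<longleftrightarrow> (\<forall>k. \<alpha> k = 0)"
      "(\<forall>a z w. sd_coeff (-1) (\<lambda>x y. ?W x y z w) a = 0) \<longleftrightarrow> (\<forall>k. \<beta> k = 0)"
    by (rule weyl_quaternionic_decomposition[OF W weyl_ricci_flat[OF assms(3,1)]]) (rule that)
  note two = self_dual_iff[OF W e_def[symmetric], unfolded sd]
  \<comment> \<open>In \<open>W y x x w\<close> the factor \<open>\<Phi> k y \<bullet> x\<close>
    equals \<open>- (y \<bullet> \<Phi> k x)\<close>, so the coefficients of the Jacobi operator are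
    the negatives of \<open>\<alpha>\<close> and \<open>\<beta>\<close>.\<close>
  have jacobi: "weyl_jacobi_op R x y = (\<Sum>k\<in>UNIV. (- \<alpha> k * (y \<bullet> \<Phi> k x)) *\<^sub>R \<Phi> k x)
      + (\<Sum>k\<in>UNIV. (- \<beta> k * (y \<bullet> \<Psi> k x)) *\<^sub>R \<Psi> k x)" for x y
  proof -
    have "weyl_jacobi_op R x y \<bullet> w = ((\<Sum>k\<in>UNIV. (- \<alpha> k * (y \<bullet> \<Phi> k x)) *\<^sub>R \<Phi> k x)
      + (\<Sum>k\<in>UNIV. (- \<beta> k * (y \<bullet> \<Psi> k x)) *\<^sub>R \<Psi> k x)) \<bullet> w" for w
    proof -
      have "\<Phi> k y \<bullet> x = - (y \<bullet> \<Phi> k x)" "\<Psi> k y \<bullet> x = - (y \<bullet> \<Psi> k x)" for k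
        by (rule quaternionicD(2)[OF \<Phi>] quaternionicD(2)[OF \<Psi>])+
      then show ?thesis
        unfolding weyl_jacobi_op_def weyl_tensor_def[symmetric] dec
        by (simp only: inner_add_left inner_sum_left inner_scaleR_left mult_minus_left mult_minus_right)
    qed
    then show ?thesis by (rule iffD1[OF vector_eq_rdot, OF allI])
  qed
  have 12: "self_dual \<O> ?W \<or> anti_self_dual \<O> ?W" if "conformally_osserman R"
  proof -
    have "(\<forall>k. - \<alpha> k = 0) \<or> (\<forall>k. - \<beta> k = 0)"
    proof (rule eigenvalues_constant_imp_zero[where \<alpha> = "\<lambda>k. - \<alpha> k" and \<beta> = "\<lambda>k. - \<beta> k",
          OF assms(1) \<Phi> \<Psi> comm _ _ jacobi])
      show "eigenvalues (weyl_jacobi_op R x) = eigenvalues (weyl_jacobi_op R x')"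
        if "x \<bullet> x = 1" "x' \<bullet> x' = 1" for x x'
      proof -
        have "x \<in> sphere 0 1" "x' \<in> sphere 0 1" using that by (simp_all add: norm_eq_1)
        then show ?thesis
          using \<open>conformally_osserman R\<close> unfolding conformally_osserman_def by blast
      qed
    qed (simp_all add: sum_negf \<alpha> \<beta>)
    then show ?thesis using two by auto
  qed
  let ?three = "\<exists>(\<Phi> :: 3 \<Rightarrow> 'a \<Rightarrow> 'a) c. quaternionic \<Phi> \<and> (\<Sum>k\<in>UNIV. c k) = 0 \<and>
      (\<forall>x y z. weyl_op R x y z = (\<Sum>k\<in>UNIV. c k *\<^sub>R R_Phi (\<Phi> k) x y z))"
  have one_sided: ?three
    if F: "quaternionic F" and a: "(\<Sum>k\<in>UNIV. a k) = 0"
      and "\<And>x y z w. ?W x y z w = (\<Sum>k\<in>UNIV. a k * (F k x \<bullet> y) * (F k z \<bullet> w))" for F a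
  proof -
    have "weyl_op R x y z = (\<Sum>k\<in>UNIV. (- a k / 3) *\<^sub>R R_Phi (F k) x y z)" for x y z
      using R_Phi_sum[OF W that(1,3), of x y z, symmetric] unfolding weyl_tensor_def
      by (rule iffD1[OF vector_eq_rdot, OF allI])
    moreover have "(\<Sum>k\<in>UNIV. - a k / 3) = 0"
      by (simp add: sum_negf sum_divide_distrib[symmetric] a)
    ultimately show ?thesis using F by (intro exI[of _ F] exI[of _ "\<lambda>k. - a k / 3"]) blast
  qed
  have 23: ?three if "self_dual \<O> ?W \<or> anti_self_dual \<O> ?W"
  proof (cases "\<forall>k. \<beta> k = 0")
    case True
    then show ?thesis by (intro one_sided[OF \<Phi> \<alpha>]) (simp add: dec)
  next
    case False
    with that two have "\<forall>k. \<alpha> k = 0" by blast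
    then show ?thesis by (intro one_sided[OF \<Psi> \<beta>]) (simp add: dec)
  qed
  have 31: "conformally_osserman R" if ?three
  proof -
    from that obtain F :: "3 \<Rightarrow> 'a \<Rightarrow> 'a" and c where F: "quaternionic F"
      and c: "\<And>x y z. weyl_op R x y z = (\<Sum>k\<in>UNIV. c k *\<^sub>R R_Phi (F k) x y z)" by blast
    \<comment> \<open>The frame formed by \<open>x\<close> and the \<open>F k x\<close> diagonalizes
      the Jacobi operator at each unit \<open>x\<close>, with diagonal entries that do not involve
      \<open>x\<close>.\<close>
    have "weyl_jacobi_op R x y = (\<Sum>k\<in>UNIV. ((3 * c k) * (y \<bullet> F k x)) *\<^sub>R F k x)" for x y
      unfolding weyl_jacobi_op_def c R_Phi_jacobi[OF F] by (simp add: mult_ac)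
    then have "eigenvalues (weyl_jacobi_op R x) = {0, 3 * c 1, 3 * c 2, 3 * c 3}" if "x \<bullet> x = 1" for x
      by (rule eigenvalues_quaternionic_frame[OF assms(1) F that])
    then show ?thesis by (simp add: conformally_osserman_def norm_eq_1)
  qed
  show ?thesis
    unfolding unitary_quaternion_structure_iff using 12 23 31 by blast
qed

end
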